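(* Let $\Gamma$ be a finite group. Then $\mathcal{R}_\Gamma\subseteq\mathcal{U}(\mathbb{Q}\Gamma_* )$ is a Hopf subalgebra (over $\mathbb{Z}$).
   Context: $\Gamma_*$ is the set of conjugacy classes of $\Gamma$, each identified with its class sum. Let $\mathfrak{g}=\mathbb{Q}\Gamma_*=Z(\mathbb{Q}\Gamma)$, regarded as an abelian Lie algebra, with canonical map $\iota:\mathfrak{g}\to\mathcal{U}(\mathfrak{g})$ to its universal enveloping algebra; $\mathcal{U}(\mathfrak{g})$ has its usual Hopf algebra structure, in which elements of $\iota(\mathfrak{g})$ are primitive. Let $T:\mathfrak{g}[[x_c:c\in\Gamma_*]]\to\mathcal{U}(\mathfrak{g})[[x_c:c\in\Gamma_*]]$ apply $\iota$ coefficientwise. Define $B_{\mathbf{N}}\in\mathcal{U}(\mathfrak{g})$ for $\mathbf{N}\in\mathbb{Z}_{\ge0}^{\Gamma_*}$ by $\exp(T(\log(1+\sum_cc\,x_c)))=\sum_{\mathbf{N}}B_{\mathbf{N}}\prod_cx_c^{\mathbf{N}(c)}$, the logarithm being computed with the associative product of $\mathbb{Q}\Gamma_*$. $\mathcal{R}_\Gamma$ is the $\mathbb{Z}$-span of the $B_{\mathbf{N}}$; it is a subring of $\mathcal{U}(\mathfrak{g})$ and is free over $\mathbb{Z}$ on the $B_{\mathbf{N}}$. "Hopf subalgebra" means a $\mathbb{Z}$-subalgebra $H$ with $\Delta(H)\subseteq H\otimes_{\mathbb{Z}}H$ (viewed inside $\mathcal{U}(\mathfrak{g})\otimes_{\mathbb{Q}}\mathcal{U}(\mathfrak{g})$),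 $\varepsilon(H)\subseteq\mathbb{Z}$ and $S(H)\subseteq H$. *)

theory Defs
  imports Complex_Main "HOL-Library.Poly_Mapping"
begin

section \<open>Vector spaces, algebras and Lie algebras over the rationals\<close>

class rat_vector = ab_group_add +
  fixes scaleQ :: "rat \<Rightarrow> 'a \<Rightarrow> 'a"  (infixr \<open>*\<^sub>Q\<close> 75)
  assumes scaleQ_add_right: "q *\<^sub>Q (x + y) = q *\<^sub>Q x + q *\<^sub>Q y"
    and scaleQ_add_left: "(p + q) *\<^sub>Q x = p *\<^sub>Q x + q *\<^sub>Q x"
    and scaleQ_scaleQ: "p *\<^sub>Q q *\<^sub>Q x = (p * q) *\<^sub>Q x"
    and scaleQ_one: "1 *\<^sub>Q x = x"

class rat_algebra = rat_vector + ring_1 +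
  assumes mult_scaleQ_left: "(q *\<^sub>Q x) * y = q *\<^sub>Q (x * y)"
    and mult_scaleQ_right: "x * (q *\<^sub>Q y) = q *\<^sub>Q (x * y)"

class rat_lie_algebra = rat_vector +
  fixes bracket :: "'a \<Rightarrow> 'a \<Rightarrow> 'a"
  assumes bracket_add_left: "bracket (x + y) z = bracket x z + bracket y z"
    and bracket_add_right: "bracket x (y + z) = bracket x y + bracket x z"
    and bracket_scaleQ_left: "bracket (q *\<^sub>Q x) y = q *\<^sub>Q bracket x y"
    and bracket_scaleQ_right: "bracket x (q *\<^sub>Q y) = q *\<^sub>Q bracket x y"
    and bracket_self: "bracket x x = 0"
    and jacobi: "bracket x (bracket y z) + bracket y (bracket z x) + bracket z (bracket x y) = 0"

global_interpretation rat_vec: vector_space "scaleQ :: rat \<Rightarrow> 'a \<Rightarrow> 'a::rat_vector"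
  by standard (simp_all add: scaleQ_add_right scaleQ_add_left scaleQ_scaleQ scaleQ_one)

global_interpretation int_mod: module "\<lambda>(n::int) (x::'a::ring_1). of_int n * x"
  by standard (simp_all add: algebra_simps)

instantiation rat :: rat_algebra
begin
definition scaleQ_rat :: "rat \<Rightarrow> rat \<Rightarrow> rat" where "scaleQ_rat = (*)"
instance by standard (simp_all add: scaleQ_rat_def algebra_simps)
end

instantiation poly_mapping :: (type, rat_vector) rat_vector
begin
lift_definition scaleQ_poly_mapping :: "rat \<Rightarrow> ('a \<Rightarrow>\<^sub>0 'b) \<Rightarrow> ('a \<Rightarrow>\<^sub>0 'b)"
  is "\<lambda>q f k. q *\<^sub>Q f k"
  by (erule rev_finite_subset) auto
instance
  by standard (transfer; simp add: fun_eq_iff scaleQ_add_right scaleQ_add_left)+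
end

lemma lookup_scaleQ: "Poly_Mapping.lookup (q *\<^sub>Q f) k = q *\<^sub>Q Poly_Mapping.lookup f k"
  by transfer simp

lemma scaleQ_single: "q *\<^sub>Q Poly_Mapping.single k a = Poly_Mapping.single k (q *\<^sub>Q a)"
  by (rule poly_mapping_eqI) (simp add: lookup_scaleQ lookup_single when_def)

lemma poly_mapping_add_induct [case_names zero single add]:
  assumes "P 0" "\<And>k c. P (Poly_Mapping.single k c)" "\<And>f g. P f \<Longrightarrow> P g \<Longrightarrow> P (f + g)"
  shows "P (f :: 'k \<Rightarrow>\<^sub>0 'c::ab_group_add)"
proof (induction f rule: update_induct)
  case const show ?case by (rule assms(1))
next
  case (update f a b)
  have "Poly_Mapping.update a b f = Poly_Mapping.single a b + f"
    using update.hyps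
    by (intro poly_mapping_eqI) (auto simp: lookup_update lookup_add lookup_single when_def in_keys_iff)
  then show ?case using assms(2,3) update.IH by simp
qed

instance poly_mapping :: (monoid_add, rat_algebra) rat_algebra
proof
  fix q :: rat and x y :: "'a \<Rightarrow>\<^sub>0 'b"
  show "(q *\<^sub>Q x) * y = q *\<^sub>Q (x * y)"
  proof (induction x rule: poly_mapping_add_induct)
    case (single k c)
    show ?case
      by (induction y rule: poly_mapping_add_induct)
        (simp_all add: scaleQ_single mult_single mult_scaleQ_left distrib_left scaleQ_add_right)
  qed (simp_all add: distrib_right scaleQ_add_right)
  show "x * (q *\<^sub>Q y) = q *\<^sub>Q (x * y)"
  proof (induction x rule: poly_mapping_add_induct)
    case (single k c)
    show ?case
      by (induction y rule: poly_mapping_add_induct)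
        (simp_all add: scaleQ_single mult_single mult_scaleQ_right distrib_left scaleQ_add_right)
  qed (simp_all add: distrib_right scaleQ_add_right)
qed

definition lin_ext :: "('k \<Rightarrow> 'v::rat_vector) \<Rightarrow> ('k \<Rightarrow>\<^sub>0 rat) \<Rightarrow> 'v" where
  "lin_ext f p = (\<Sum>k\<in>Poly_Mapping.keys p. Poly_Mapping.lookup p k *\<^sub>Q f k)"

lemma lin_ext_superset:
  assumes "finite A" "Poly_Mapping.keys p \<subseteq> A"
  shows "lin_ext f p = (\<Sum>k\<in>A. Poly_Mapping.lookup p k *\<^sub>Q f k)"
  unfolding lin_ext_def using assms by (intro sum.mono_neutral_left) (auto simp: in_keys_iff)

lemma lin_ext_0 [simp]: "lin_ext f 0 = 0"
  by (simp add: lin_ext_def)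

lemma lin_ext_add: "lin_ext f (p + q) = lin_ext f p + lin_ext f q"
proof -
  let ?A = "Poly_Mapping.keys p \<union> Poly_Mapping.keys q"
  have "Poly_Mapping.keys (p + q) \<subseteq> ?A" by (rule Poly_Mapping.keys_add)
  then show ?thesis
    by (simp add: lin_ext_superset[of ?A] lookup_add scaleQ_add_left sum.distrib)
qed

lemma lin_ext_single [simp]: "lin_ext f (Poly_Mapping.single k c) = c *\<^sub>Q f k"
  by (subst lin_ext_superset[of "{k}"]) auto

lemma lin_ext_scaleQ: "lin_ext f (q *\<^sub>Q p) = q *\<^sub>Q lin_ext f p"
  by (induction p rule: poly_mapping_add_induct)
    (simp_all add: scaleQ_single lin_ext_add scaleQ_add_right scaleQ_rat_def)

lemma lin_ext_minus: "lin_ext f (- p) = - lin_ext f p"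
  using lin_ext_add[of f p "- p"] by (simp add: eq_neg_iff_add_eq_0 add.commute)

lemma lin_ext_diff: "lin_ext f (p - q) = lin_ext f p - lin_ext f q"
  using lin_ext_add[of f p "- q"] by (simp add: lin_ext_minus)

lemma lin_ext_mult:
  fixes f :: "'k::monoid_add \<Rightarrow> 'v::rat_algebra"
  assumes "\<And>k l. f (k + l) = f k * f l"
  shows "lin_ext f (p * q) = lin_ext f p * lin_ext f q"
proof (induction p rule: poly_mapping_add_induct)
  case (single k c)
  show ?case
    by (induction q rule: poly_mapping_add_induct)
      (simp_all add: mult_single assms mult_scaleQ_left mult_scaleQ_right scaleQ_scaleQ mult.commute
        distrib_left lin_ext_add)
qed (simp_all add: distrib_right lin_ext_add)


section \<open>Opposite algebra\<close>

typedef 'a opp = "UNIV :: 'a set" morphisms from_opp to_opp ..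

setup_lifting type_definition_opp

instantiation opp :: (rat_algebra) rat_algebra
begin
lift_definition zero_opp :: "'a opp" is 0 .
lift_definition one_opp :: "'a opp" is 1 .
lift_definition plus_opp :: "'a opp \<Rightarrow> 'a opp \<Rightarrow> 'a opp" is "(+)" .
lift_definition minus_opp :: "'a opp \<Rightarrow> 'a opp \<Rightarrow> 'a opp" is "(-)" .
lift_definition uminus_opp :: "'a opp \<Rightarrow> 'a opp" is uminus .
lift_definition times_opp :: "'a opp \<Rightarrow> 'a opp \<Rightarrow> 'a opp" is "\<lambda>x y. y * x" .
lift_definition scaleQ_opp :: "rat \<Rightarrow> 'a opp \<Rightarrow> 'a opp" is scaleQ .
instance
  by standard (transfer; simp add: algebra_simps scaleQ_add_right scaleQ_add_left
      mult_scaleQ_left mult_scaleQ_right)+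
end


section \<open>Tensor product of algebras\<close>

text \<open>The free vector space on the pairs \<open>(a, b)\<close> is a monoid algebra. As multiplication of
  finitely supported functions is governed by an additive monoid of keys, the componentwise
  product of pairs is written additively.\<close>

datatype ('a, 'b) elem_pair = Pair_of 'a 'b

instantiation elem_pair :: (monoid_mult, monoid_mult) monoid_add
begin
definition zero_elem_pair :: "('a, 'b) elem_pair" where "zero_elem_pair = Pair_of 1 1"
fun plus_elem_pair :: "('a, 'b) elem_pair \<Rightarrow> ('a, 'b) elem_pair \<Rightarrow> ('a, 'b) elem_pair" where
  "plus_elem_pair (Pair_of a b) (Pair_of c d) = Pair_of (a * c) (b * d)"
instance
proof
  fix x y z :: "('a, 'b) elem_pair"
  show "x + y + z = x + (y + z)" by (cases x; cases y; cases z) (simp add: mult.assoc)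
  show "0 + x = x" "x + 0 = x" by (cases x; simp add: zero_elem_pair_def)+
qed
end

abbreviation free_pair :: "'a \<Rightarrow> 'b \<Rightarrow> ('a, 'b) elem_pair \<Rightarrow>\<^sub>0 rat" where
  "free_pair a b \<equiv> Poly_Mapping.single (Pair_of a b) 1"

definition tensor_null :: "(('a::rat_algebra, 'b::rat_algebra) elem_pair \<Rightarrow>\<^sub>0 rat) set" where
  "tensor_null = rat_vec.span
     ({free_pair (a + a') b - free_pair a b - free_pair a' b | a a' b. True} \<union>
      {free_pair a (b + b') - free_pair a b - free_pair a b' | a b b'. True} \<union>
      {free_pair (q *\<^sub>Q a) b - q *\<^sub>Q free_pair a b | q a b. True} \<union>
      {free_pair a (q *\<^sub>Q b) - q *\<^sub>Q free_pair a b | q a b. True})"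

lemma tensor_null_gens:
  "free_pair (a + a') b - free_pair a b - free_pair a' b \<in> tensor_null"
  "free_pair a (b + b') - free_pair a b - free_pair a b' \<in> tensor_null"
  "free_pair (q *\<^sub>Q a) b - q *\<^sub>Q free_pair a b \<in> tensor_null"
  "free_pair a (q *\<^sub>Q b) - q *\<^sub>Q free_pair a b \<in> tensor_null"
  unfolding tensor_null_def by (rule rat_vec.span_base; blast)+

lemma tensor_null_add: "x \<in> tensor_null \<Longrightarrow> y \<in> tensor_null \<Longrightarrow> x + y \<in> tensor_null"
  unfolding tensor_null_def by (rule rat_vec.span_add)

lemma tensor_null_scaleQ: "x \<in> tensor_null \<Longrightarrow> q *\<^sub>Q x \<in> tensor_null"
  unfolding tensor_null_def by (rule rat_vec.span_scale)

lemma tensor_null_0: "0 \<in> tensor_null"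
  unfolding tensor_null_def by (rule rat_vec.span_zero)

lemma tensor_null_minus: "x \<in> tensor_null \<Longrightarrow> - x \<in> tensor_null"
  unfolding tensor_null_def by (rule rat_vec.span_neg)

lemma tensor_null_induct [consumes 1, case_names zero add scaleQ addl addr scalel scaler]:
  assumes "x \<in> tensor_null"
    and "P 0" "\<And>x y. P x \<Longrightarrow> P y \<Longrightarrow> P (x + y)" "\<And>q x. P x \<Longrightarrow> P (q *\<^sub>Q x)"
    and "\<And>a a' b. P (free_pair (a + a') b - free_pair a b - free_pair a' b)"
    and "\<And>a b b'. P (free_pair a (b + b') - free_pair a b - free_pair a b')"
    and "\<And>q a b. P (free_pair (q *\<^sub>Q a) b - q *\<^sub>Q free_pair a b)"
    and "\<And>q a b. P (free_pair a (q *\<^sub>Q b) - q *\<^sub>Q free_pair a b)"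
  shows "P x"
proof -
  have "rat_vec.subspace (Collect P)"
    using assms(2-4) by (auto simp: rat_vec.subspace_def)
  then have "tensor_null \<subseteq> Collect P"
    unfolding tensor_null_def using assms(5-8) by (intro rat_vec.span_minimal) auto
  then show ?thesis using assms(1) by auto
qed

lemma tensor_null_mult_left:
  assumes "x \<in> tensor_null" shows "y * x \<in> tensor_null"
proof (induction y rule: poly_mapping_add_induct)
  case (single k c)
  obtain a' b' where k: "k = Pair_of a' b'" by (cases k)
  have "free_pair a' b' * x \<in> tensor_null"
    using assms
    by (induction x rule: tensor_null_induct)
      (simp_all add: tensor_null_0 tensor_null_add tensor_null_scaleQ tensor_null_gens distrib_left
        right_diff_distrib mult_scaleQ_right mult_single mult_scaleQ_left)
  then have "c *\<^sub>Q (free_pair a' b' * x) \<in> tensor_null" by (rule tensor_null_scaleQ)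
  moreover have "Poly_Mapping.single k c * x = c *\<^sub>Q (free_pair a' b' * x)"
    by (simp add: k scaleQ_single scaleQ_rat_def flip: mult_scaleQ_left)
  ultimately show ?case by simp
qed (simp_all add: tensor_null_0 tensor_null_add distrib_right)

lemma tensor_null_mult_right:
  assumes "x \<in> tensor_null" shows "x * y \<in> tensor_null"
proof (induction y rule: poly_mapping_add_induct)
  case (single k c)
  obtain a' b' where k: "k = Pair_of a' b'" by (cases k)
  have "x * free_pair a' b' \<in> tensor_null"
    using assms
    by (induction x rule: tensor_null_induct)
      (simp_all add: tensor_null_0 tensor_null_add tensor_null_scaleQ tensor_null_gens distrib_right
        left_diff_distrib mult_scaleQ_right mult_single mult_scaleQ_left)
  then have "c *\<^sub>Q (x * free_pair a' b') \<in> tensor_null" by (rule tensor_null_scaleQ)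
  moreover have "x * Poly_Mapping.single k c = c *\<^sub>Q (x * free_pair a' b')"
    by (simp add: k scaleQ_single scaleQ_rat_def flip: mult_scaleQ_right)
  ultimately show ?case by simp
qed (simp_all add: tensor_null_0 tensor_null_add distrib_left)

lemma ex_functional:
  "\<exists>\<phi>. (\<forall>x y. \<phi> (x + y) = \<phi> x + \<phi> y) \<and> (\<forall>q x. \<phi> (q *\<^sub>Q x) = q * \<phi> x) \<and> \<phi> (1::'a::rat_algebra) = (1::rat)"
proof -
  interpret vector_space_pair "scaleQ :: rat \<Rightarrow> 'a \<Rightarrow> 'a" "scaleQ :: rat \<Rightarrow> rat \<Rightarrow> rat" ..
  have "rat_vec.independent {1::'a}" by simp
  from linear_independent_extend[OF this, of "\<lambda>_. 1"]
  obtain g :: "'a \<Rightarrow> rat" where g: "Vector_Spaces.linear scaleQ scaleQ g" "g 1 = 1" by auto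
  have "g (q *\<^sub>Q x) = q * g x" for q x
    using linear_scale[OF g(1), of q x] by (simp only: scaleQ_rat_def)
  then show ?thesis
    using linear_add[OF g(1)] g(2) by blast
qed

lemma one_notin_tensor_null: "1 \<notin> (tensor_null :: (('a::rat_algebra, 'b::rat_algebra) elem_pair \<Rightarrow>\<^sub>0 rat) set)"
proof
  assume *: "1 \<in> (tensor_null :: (('a, 'b) elem_pair \<Rightarrow>\<^sub>0 rat) set)"
  obtain \<phi> :: "'a \<Rightarrow> rat" where \<phi>: "\<And>x y. \<phi> (x + y) = \<phi> x + \<phi> y" "\<And>q x. \<phi> (q *\<^sub>Q x) = q * \<phi> x" "\<phi> 1 = 1"
    using ex_functional by blast
  obtain \<psi> :: "'b \<Rightarrow> rat" where \<psi>: "\<And>x y. \<psi> (x + y) = \<psi> x + \<psi> y" "\<And>q x. \<psi> (q *\<^sub>Q x) = q * \<psi> x" "\<psi> 1 = 1"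
    using ex_functional by blast
  define \<theta> where "\<theta> = lin_ext (case_elem_pair (\<lambda>a b. \<phi> a * \<psi> b))"
  have "\<theta> x = 0" if "x \<in> tensor_null" for x
    using that unfolding \<theta>_def
    by (induction x rule: tensor_null_induct)
      (simp_all add: lin_ext_add lin_ext_diff lin_ext_scaleQ \<phi>(1,2) \<psi>(1,2) scaleQ_rat_def distrib_left
        distrib_right)
  then have "\<theta> 1 = 0" using * by blast
  moreover have "\<theta> 1 = 1"
    unfolding \<theta>_def single_one[symmetric] zero_elem_pair_def lin_ext_single
    by (simp add: \<phi>(3) \<psi>(3) scaleQ_rat_def)
  ultimately show False by simp
qed

definition tensor_rel ::
  "(('a::rat_algebra, 'b::rat_algebra) elem_pair \<Rightarrow>\<^sub>0 rat) \<Rightarrow> (('a, 'b) elem_pair \<Rightarrow>\<^sub>0 rat) \<Rightarrow> bool" where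
  "tensor_rel x y \<longleftrightarrow> x - y \<in> tensor_null"

lemma equivp_tensor_rel: "equivp tensor_rel"
proof (rule equivpI)
  show "reflp tensor_rel" by (rule reflpI) (simp add: tensor_rel_def tensor_null_0)
  show "symp tensor_rel"
    unfolding tensor_rel_def by (rule sympI) (drule tensor_null_minus, simp)
  show "transp tensor_rel"
    unfolding tensor_rel_def
  proof (rule transpI)
    fix x y z assume "x - y \<in> tensor_null" "y - z \<in> tensor_null"
    from tensor_null_add[OF this] show "x - z \<in> tensor_null" by simp
  qed
qed

lemma tensor_rel_eqI: "x = y \<Longrightarrow> tensor_rel x y"
  by (simp add: tensor_rel_def tensor_null_0)

quotient_type (overloaded) ('a, 'b) tensor =
  "('a::rat_algebra, 'b::rat_algebra) elem_pair \<Rightarrow>\<^sub>0 rat" / tensor_rel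
  by (rule equivp_tensor_rel)

instantiation tensor :: (rat_algebra, rat_algebra) rat_algebra
begin
lift_definition zero_tensor :: "('a, 'b) tensor" is 0 .
lift_definition one_tensor :: "('a, 'b) tensor" is 1 .
lift_definition plus_tensor :: "('a, 'b) tensor \<Rightarrow> ('a, 'b) tensor \<Rightarrow> ('a, 'b) tensor" is "(+)"
  unfolding tensor_rel_def by (subst add_diff_add) (rule tensor_null_add)
lift_definition uminus_tensor :: "('a, 'b) tensor \<Rightarrow> ('a, 'b) tensor" is uminus
  unfolding tensor_rel_def minus_diff_minus by (rule tensor_null_minus)
lift_definition minus_tensor :: "('a, 'b) tensor \<Rightarrow> ('a, 'b) tensor \<Rightarrow> ('a, 'b) tensor" is "(-)"
proof -
  fix x x' y y' :: "('a, 'b) elem_pair \<Rightarrow>\<^sub>0 rat"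
  assume "tensor_rel x x'" "tensor_rel y y'"
  then have "(x - x') + - (y - y') \<in> tensor_null"
    unfolding tensor_rel_def by (intro tensor_null_add tensor_null_minus)
  moreover have "(x - x') + - (y - y') = (x - y) - (x' - y')" by simp
  ultimately show "tensor_rel (x - y) (x' - y')" by (simp only: tensor_rel_def)
qed
lift_definition scaleQ_tensor :: "rat \<Rightarrow> ('a, 'b) tensor \<Rightarrow> ('a, 'b) tensor" is scaleQ
  unfolding tensor_rel_def rat_vec.scale_right_diff_distrib[symmetric] by (rule tensor_null_scaleQ)
lift_definition times_tensor :: "('a, 'b) tensor \<Rightarrow> ('a, 'b) tensor \<Rightarrow> ('a, 'b) tensor" is "(*)"
proof -
  fix x x' y y' :: "('a, 'b) elem_pair \<Rightarrow>\<^sub>0 rat"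
  assume "tensor_rel x x'" "tensor_rel y y'"
  then have "(x - x') * y + x' * (y - y') \<in> tensor_null"
    unfolding tensor_rel_def by (intro tensor_null_add tensor_null_mult_left tensor_null_mult_right)
  then show "tensor_rel (x * y) (x' * y')"
    by (simp add: tensor_rel_def left_diff_distrib right_diff_distrib)
qed
instance
proof
  show "(0::('a, 'b) tensor) \<noteq> 1"
  proof
    assume "(0::('a, 'b) tensor) = 1"
    then have "tensor_rel 0 (1 :: ('a, 'b) elem_pair \<Rightarrow>\<^sub>0 rat)" by transfer
    then show False using tensor_null_minus[of "0 - 1"] one_notin_tensor_null unfolding tensor_rel_def by auto
  qed
qed (transfer, rule tensor_rel_eqI, simp add: add.assoc add.commute mult.assoc distrib_left distrib_right
    scaleQ_add_right scaleQ_add_left mult_scaleQ_left mult_scaleQ_right)+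
end

lift_definition tensor :: "'a::rat_algebra \<Rightarrow> 'b::rat_algebra \<Rightarrow> ('a, 'b) tensor"  (infixl \<open>\<otimes>\<^sub>Q\<close> 73)
  is free_pair .

lemma tensor_simps:
  "(a + a') \<otimes>\<^sub>Q b = a \<otimes>\<^sub>Q b + a' \<otimes>\<^sub>Q b"
  "a \<otimes>\<^sub>Q (b + b') = a \<otimes>\<^sub>Q b + a \<otimes>\<^sub>Q b'"
  "(q *\<^sub>Q a) \<otimes>\<^sub>Q b = q *\<^sub>Q (a \<otimes>\<^sub>Q b)"
  "a \<otimes>\<^sub>Q (q *\<^sub>Q b) = q *\<^sub>Q (a \<otimes>\<^sub>Q b)"
  "(a \<otimes>\<^sub>Q b) * (a' \<otimes>\<^sub>Q b') = (a * a') \<otimes>\<^sub>Q (b * b')"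
  "(1 :: 'a::rat_algebra) \<otimes>\<^sub>Q (1 :: 'b::rat_algebra) = 1"
  by (transfer, simp add: tensor_rel_def tensor_null_0 tensor_null_gens[unfolded diff_diff_eq]
      mult_single zero_elem_pair_def flip: single_one)+


section \<open>Universal enveloping algebra\<close>

text \<open>\<open>\<U>(\<gg>)\<close> is the free unital associative algebra on the set \<open>\<gg>\<close> modulo the two-sided
  ideal that makes the canonical map linear and turns the bracket into the commutator. Words are
  added by concatenation.\<close>

datatype 'a word = Word (letters: "'a list")

instantiation word :: (type) monoid_add
begin
definition zero_word :: "'a word" where "zero_word = Word []"
definition plus_word :: "'a word \<Rightarrow> 'a word \<Rightarrow> 'a word" where
  "plus_word v w = Word (letters v @ letters w)"
instance by standard (simp_all add: zero_word_def plus_word_def)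
end

abbreviation letter :: "'l \<Rightarrow> 'l word \<Rightarrow>\<^sub>0 rat" where
  "letter x \<equiv> Poly_Mapping.single (Word [x]) 1"

inductive_set uea_ideal :: "('l::rat_lie_algebra word \<Rightarrow>\<^sub>0 rat) set" where
  add_rel: "letter (x + y) - letter x - letter y \<in> uea_ideal"
| scaleQ_rel: "letter (q *\<^sub>Q x) - q *\<^sub>Q letter x \<in> uea_ideal"
| bracket_rel: "letter (bracket x y) - (letter x * letter y - letter y * letter x) \<in> uea_ideal"
| zero: "0 \<in> uea_ideal"
| add: "a \<in> uea_ideal \<Longrightarrow> b \<in> uea_ideal \<Longrightarrow> a + b \<in> uea_ideal"
| mult: "a \<in> uea_ideal \<Longrightarrow> l * a * r \<in> uea_ideal"

definition word_eval :: "('l \<Rightarrow> 'a::rat_algebra) \<Rightarrow> ('l word \<Rightarrow>\<^sub>0 rat) \<Rightarrow> 'a" where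
  "word_eval f = lin_ext (\<lambda>w. prod_list (map f (letters w)))"

definition lie_hom :: "('l::rat_lie_algebra \<Rightarrow> 'a::rat_algebra) \<Rightarrow> bool" where
  "lie_hom f \<longleftrightarrow> (\<forall>x y. f (x + y) = f x + f y) \<and> (\<forall>q x. f (q *\<^sub>Q x) = q *\<^sub>Q f x) \<and>
     (\<forall>x y. f (bracket x y) = f x * f y - f y * f x)"

lemma word_eval_simps:
  "word_eval f 0 = 0"
  "word_eval f 1 = 1"
  "word_eval f (p + q) = word_eval f p + word_eval f q"
  "word_eval f (p - q) = word_eval f p - word_eval f q"
  "word_eval f (- p) = - word_eval f p"
  "word_eval f (c *\<^sub>Q p) = c *\<^sub>Q word_eval f p"
  "word_eval f (p * q) = word_eval f p * word_eval f q"
  "word_eval f (letter x) = f x"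
  unfolding word_eval_def
  by (simp_all add: lin_ext_add lin_ext_diff lin_ext_minus lin_ext_scaleQ)
    (simp_all add: zero_word_def lin_ext_mult plus_word_def flip: single_one)

lemma word_eval_ideal: "lie_hom f \<Longrightarrow> p \<in> uea_ideal \<Longrightarrow> word_eval f p = 0"
  by (erule uea_ideal.induct) (simp_all add: word_eval_simps lie_hom_def)

lemma uea_ideal_mult_left: "a \<in> uea_ideal \<Longrightarrow> l * a \<in> uea_ideal"
  using uea_ideal.mult[of a l 1] by simp

lemma uea_ideal_mult_right: "a \<in> uea_ideal \<Longrightarrow> a * r \<in> uea_ideal"
  using uea_ideal.mult[of a 1 r] by simp

lemma uea_ideal_minus: "a \<in> uea_ideal \<Longrightarrow> - a \<in> uea_ideal"
  using uea_ideal_mult_left[of a "-1"] by simp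

lemma uea_ideal_scaleQ: "a \<in> uea_ideal \<Longrightarrow> q *\<^sub>Q a \<in> uea_ideal"
  using uea_ideal_mult_left[of a "q *\<^sub>Q 1"] by (simp add: mult_scaleQ_left)

lemma one_notin_uea_ideal: "1 \<notin> uea_ideal"
proof
  assume "(1 :: 'a word \<Rightarrow>\<^sub>0 rat) \<in> uea_ideal"
  then have "word_eval (\<lambda>_. 0 :: rat) (1 :: 'a word \<Rightarrow>\<^sub>0 rat) = 0"
    by (rule word_eval_ideal[rotated]) (simp add: lie_hom_def)
  then show False by (simp add: word_eval_simps)
qed

definition uea_rel :: "('l::rat_lie_algebra word \<Rightarrow>\<^sub>0 rat) \<Rightarrow> ('l word \<Rightarrow>\<^sub>0 rat) \<Rightarrow> bool" where
  "uea_rel a b \<longleftrightarrow> a - b \<in> uea_ideal"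

lemma equivp_uea_rel: "equivp uea_rel"
proof (rule equivpI)
  show "reflp uea_rel" by (rule reflpI) (simp add: uea_rel_def uea_ideal.zero)
  show "symp uea_rel"
    unfolding uea_rel_def by (rule sympI) (drule uea_ideal_minus, simp)
  show "transp uea_rel"
    unfolding uea_rel_def
  proof (rule transpI)
    fix x y z assume "x - y \<in> uea_ideal" "y - z \<in> uea_ideal"
    from uea_ideal.add[OF this] show "x - z \<in> uea_ideal" by simp
  qed
qed

lemma uea_rel_eqI: "x = y \<Longrightarrow> uea_rel x y"
  by (simp add: uea_rel_def uea_ideal.zero)

quotient_type (overloaded) 'l uea = "'l::rat_lie_algebra word \<Rightarrow>\<^sub>0 rat" / uea_rel
  by (rule equivp_uea_rel)

instantiation uea :: (rat_lie_algebra) rat_algebra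
begin
lift_definition zero_uea :: "'a uea" is 0 .
lift_definition one_uea :: "'a uea" is 1 .
lift_definition plus_uea :: "'a uea \<Rightarrow> 'a uea \<Rightarrow> 'a uea" is "(+)"
  unfolding uea_rel_def by (subst add_diff_add) (rule uea_ideal.add)
lift_definition uminus_uea :: "'a uea \<Rightarrow> 'a uea" is uminus
  unfolding uea_rel_def minus_diff_minus by (rule uea_ideal_minus)
lift_definition minus_uea :: "'a uea \<Rightarrow> 'a uea \<Rightarrow> 'a uea" is "(-)"
proof -
  fix x x' y y' :: "'a word \<Rightarrow>\<^sub>0 rat"
  assume "uea_rel x x'" "uea_rel y y'"
  then have "(x - x') + - (y - y') \<in> uea_ideal"
    unfolding uea_rel_def by (intro uea_ideal.add uea_ideal_minus)
  moreover have "(x - x') + - (y - y') = (x - y) - (x' - y')" by simp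
  ultimately show "uea_rel (x - y) (x' - y')" by (simp only: uea_rel_def)
qed
lift_definition scaleQ_uea :: "rat \<Rightarrow> 'a uea \<Rightarrow> 'a uea" is scaleQ
  unfolding uea_rel_def rat_vec.scale_right_diff_distrib[symmetric] by (rule uea_ideal_scaleQ)
lift_definition times_uea :: "'a uea \<Rightarrow> 'a uea \<Rightarrow> 'a uea" is "(*)"
proof -
  fix x x' y y' :: "'a word \<Rightarrow>\<^sub>0 rat"
  assume "uea_rel x x'" "uea_rel y y'"
  then have "(x - x') * y + x' * (y - y') \<in> uea_ideal"
    unfolding uea_rel_def by (intro uea_ideal.add uea_ideal_mult_left uea_ideal_mult_right)
  then show "uea_rel (x * y) (x' * y')"
    by (simp add: uea_rel_def left_diff_distrib right_diff_distrib)
qed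
instance
proof
  show "(0::'a uea) \<noteq> 1"
  proof
    assume "(0::'a uea) = 1"
    then have "uea_rel 0 (1 :: 'a word \<Rightarrow>\<^sub>0 rat)" by transfer
    then show False using uea_ideal_minus[of "0 - 1"] one_notin_uea_ideal unfolding uea_rel_def by auto
  qed
qed (transfer, rule uea_rel_eqI, simp add: add.assoc add.commute mult.assoc distrib_left distrib_right
    scaleQ_add_right scaleQ_add_left mult_scaleQ_left mult_scaleQ_right)+
end

lift_definition \<iota> :: "'l::rat_lie_algebra \<Rightarrow> 'l uea" is letter .

lemma lie_hom_\<iota>: "lie_hom \<iota>"
  unfolding lie_hom_def
  by (intro conjI allI; transfer; simp add: uea_rel_def uea_ideal.scaleQ_rel uea_ideal.bracket_rel
      uea_ideal.add_rel[unfolded diff_diff_eq])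

lemma \<iota>_simps:
  fixes x y :: "'l::rat_lie_algebra"
  shows "\<iota> (x + y) = \<iota> x + \<iota> y" "\<iota> (q *\<^sub>Q x) = q *\<^sub>Q \<iota> x"
    "\<iota> (bracket x y) = \<iota> x * \<iota> y - \<iota> y * \<iota> x"
  using lie_hom_\<iota>[where ?'a = 'l] by (simp_all add: lie_hom_def)

text \<open>The algebra homomorphism extending \<open>f\<close>; independent of the representative when \<open>f\<close> is a
  Lie homomorphism.\<close>

definition uea_lift :: "('l::rat_lie_algebra \<Rightarrow> 'a::rat_algebra) \<Rightarrow> 'l uea \<Rightarrow> 'a" where
  "uea_lift f u = word_eval f (rep_uea u)"

lemma uea_lift_abs: "lie_hom f \<Longrightarrow> uea_lift f (abs_uea p) = word_eval f p"
proof -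
  assume f: "lie_hom f"
  have "rep_uea (abs_uea p) - p \<in> uea_ideal"
    using Quotient3_uea equivp_uea_rel
    by (metis Quotient3_rel_rep Quotient3_abs_rep Quotient3_rep_abs equivp_reflp uea_rel_def)
  from word_eval_ideal[OF f this] show ?thesis
    by (simp add: uea_lift_def word_eval_simps)
qed

lemma uea_lift:
  assumes "lie_hom f"
  shows "uea_lift f (\<iota> x) = f x"
    "uea_lift f 0 = 0" "uea_lift f 1 = 1"
    "uea_lift f (u + v) = uea_lift f u + uea_lift f v"
    "uea_lift f (u * v) = uea_lift f u * uea_lift f v"
    "uea_lift f (q *\<^sub>Q u) = q *\<^sub>Q uea_lift f u"
proof -
  show "uea_lift f (\<iota> x) = f x"
    by (simp add: \<iota>.abs_eq uea_lift_abs[OF assms] word_eval_simps)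
  show "uea_lift f 0 = 0" "uea_lift f 1 = 1"
    by (simp_all add: zero_uea_def one_uea_def uea_lift_abs[OF assms] word_eval_simps)
  obtain p r where "u = abs_uea p" "v = abs_uea r"
    by (metis Quotient3_uea Quotient3_abs_rep)
  then show "uea_lift f (u + v) = uea_lift f u + uea_lift f v"
    "uea_lift f (u * v) = uea_lift f u * uea_lift f v"
    "uea_lift f (q *\<^sub>Q u) = q *\<^sub>Q uea_lift f u"
    by (simp_all add: plus_uea.abs_eq times_uea.abs_eq scaleQ_uea.abs_eq uea_lift_abs[OF assms]
        word_eval_simps)
qed

definition comult :: "'l::rat_lie_algebra uea \<Rightarrow> ('l uea, 'l uea) tensor" where
  "comult = uea_lift (\<lambda>x. \<iota> x \<otimes>\<^sub>Q 1 + 1 \<otimes>\<^sub>Q \<iota> x)"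

definition counit :: "'l::rat_lie_algebra uea \<Rightarrow> rat" where
  "counit = uea_lift (\<lambda>_. 0)"

definition antipode :: "'l::rat_lie_algebra uea \<Rightarrow> 'l uea" where
  "antipode u = from_opp (uea_lift (\<lambda>x. to_opp (- \<iota> x)) u)"

lemma lie_hom_comult: "lie_hom (\<lambda>x::'l::rat_lie_algebra. \<iota> x \<otimes>\<^sub>Q 1 + 1 \<otimes>\<^sub>Q \<iota> x)"
proof -
  have minus: "(a - a') \<otimes>\<^sub>Q b = a \<otimes>\<^sub>Q b - a' \<otimes>\<^sub>Q b" "b \<otimes>\<^sub>Q (a - a') = b \<otimes>\<^sub>Q a - b \<otimes>\<^sub>Q a'"
    for a a' b :: "'l uea"
    using tensor_simps(1)[of "a - a'" a' b] tensor_simps(2)[of b "a - a'" a'] by simp_all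
  show ?thesis
    unfolding lie_hom_def
    by (simp add: \<iota>_simps tensor_simps minus scaleQ_add_right distrib_left distrib_right)
qed

lemma lie_hom_counit: "lie_hom (\<lambda>_. 0)"
  by (simp add: lie_hom_def)

lemma lie_hom_antipode: "lie_hom (\<lambda>x. to_opp (- \<iota> x))"
  unfolding lie_hom_def
  by (simp add: \<iota>_simps plus_opp_def times_opp_def minus_opp_def scaleQ_opp_def to_opp_inverse)

text \<open>The image of \<open>H \<otimes>\<^bsub>\<int>\<^esub> H\<close> in \<open>\<U>(\<gg>) \<otimes>\<^sub>Q \<U>(\<gg>)\<close> is the \<open>\<int>\<close>-span of the pure tensors of elements
  of \<open>H\<close>.\<close>

definition hopf_subalgebra_over_int :: "'l::rat_lie_algebra uea set \<Rightarrow> bool" where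
  "hopf_subalgebra_over_int H \<longleftrightarrow>
     0 \<in> H \<and> 1 \<in> H \<and> (\<forall>a\<in>H. \<forall>b\<in>H. a + b \<in> H) \<and> (\<forall>a\<in>H. - a \<in> H) \<and> (\<forall>a\<in>H. \<forall>b\<in>H. a * b \<in> H) \<and>
     comult ` H \<subseteq> int_mod.span {a \<otimes>\<^sub>Q b | a b. a \<in> H \<and> b \<in> H} \<and>
     counit ` H \<subseteq> \<int> \<and>
     antipode ` H \<subseteq> H"


section \<open>Multivariate formal power series\<close>

typedef ('v, 'a) mfps = "UNIV :: (('v \<Rightarrow>\<^sub>0 nat) \<Rightarrow> 'a) set" morphisms mcoeff Abs_mfps ..

setup_lifting type_definition_mfps

lemma mfps_eqI: "(\<And>N. mcoeff F N = mcoeff G N) \<Longrightarrow> F = G"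
  by transfer auto

definition decomps :: "('v \<Rightarrow>\<^sub>0 nat) \<Rightarrow> (('v \<Rightarrow>\<^sub>0 nat) \<times> ('v \<Rightarrow>\<^sub>0 nat)) set" where
  "decomps N = {(K, L). K + L = N}"

lemma finite_decomps: "finite (decomps N)"
proof -
  let ?k = "Poly_Mapping.keys N"
  let ?F = "{f. \<forall>v. (v \<in> ?k \<longrightarrow> f v \<in> {..Max (Poly_Mapping.lookup N ` ?k)}) \<and> (v \<notin> ?k \<longrightarrow> f v = 0)}"
  have fin: "finite ?F"
    by (rule finite_set_of_finite_funs) auto
  have *: "Poly_Mapping.lookup K \<in> ?F" if "Poly_Mapping.lookup K \<le> Poly_Mapping.lookup N" for K
  proof -
    have "Poly_Mapping.lookup K v \<le> Max (Poly_Mapping.lookup N ` ?k)" if "v \<in> ?k" for v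
      using that \<open>Poly_Mapping.lookup K \<le> _\<close>
      by (meson Max_ge finite_imageI finite_keys image_eqI le_funD le_trans)
    moreover have "Poly_Mapping.lookup K v = 0" if "v \<notin> ?k" for v
      using that \<open>Poly_Mapping.lookup K \<le> _\<close> by (metis in_keys_iff le_funD le_zero_eq)
    ultimately show ?thesis by auto
  qed
  have "finite {K. Poly_Mapping.lookup K \<in> ?F}"
    using finite_vimageI[OF fin, of Poly_Mapping.lookup]
    by (simp add: vimage_def inj_on_def)
  then have "finite ({K. Poly_Mapping.lookup K \<in> ?F} \<times> {K. Poly_Mapping.lookup K \<in> ?F})" by simp
  moreover have "decomps N \<subseteq> {K. Poly_Mapping.lookup K \<in> ?F} \<times> {K. Poly_Mapping.lookup K \<in> ?F}"
  proof
    fix p assume p: "p \<in> decomps N"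
    then have **: "Poly_Mapping.lookup (fst p) \<le> Poly_Mapping.lookup N"
      "Poly_Mapping.lookup (snd p) \<le> Poly_Mapping.lookup N"
      by (auto simp: decomps_def le_fun_def lookup_add)
    show "p \<in> {K. Poly_Mapping.lookup K \<in> ?F} \<times> {K. Poly_Mapping.lookup K \<in> ?F}"
      using *[OF **(1)] *[OF **(2)] by (simp only: mem_Times_iff mem_Collect_eq)
  qed
  ultimately show ?thesis by (rule rev_finite_subset)
qed

instantiation mfps :: (type, ring_1) ring_1
begin
lift_definition zero_mfps :: "('a, 'b) mfps" is "\<lambda>_. 0" .
lift_definition one_mfps :: "('a, 'b) mfps" is "\<lambda>N. if N = 0 then 1 else 0" .
lift_definition plus_mfps :: "('a, 'b) mfps \<Rightarrow> ('a, 'b) mfps \<Rightarrow> ('a, 'b) mfps" is "\<lambda>F G N. F N + G N" .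
lift_definition minus_mfps :: "('a, 'b) mfps \<Rightarrow> ('a, 'b) mfps \<Rightarrow> ('a, 'b) mfps" is "\<lambda>F G N. F N - G N" .
lift_definition uminus_mfps :: "('a, 'b) mfps \<Rightarrow> ('a, 'b) mfps" is "\<lambda>F N. - F N" .
lift_definition times_mfps :: "('a, 'b) mfps \<Rightarrow> ('a, 'b) mfps \<Rightarrow> ('a, 'b) mfps"
  is "\<lambda>F G N. \<Sum>(K, L)\<in>decomps N. F K * G L" .
instance
proof
  fix a b c :: "('a, 'b) mfps"
  show "a * b * c = a * (b * c)"
  proof (transfer, rule ext)
    fix f g h :: "('a \<Rightarrow>\<^sub>0 nat) \<Rightarrow> 'b" and N
    have "(\<Sum>(K, L)\<in>decomps N. (\<Sum>(K1, K2)\<in>decomps K. f K1 * g K2) * h L) =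
      (\<Sum>(p, q)\<in>(SIGMA p:decomps N. decomps (fst p)). f (fst q) * g (snd q) * h (snd p))"
      by (simp add: case_prod_beta sum_distrib_right finite_decomps sum.Sigma)
    also have "\<dots> = (\<Sum>(p, q)\<in>(SIGMA p:decomps N. decomps (snd p)). f (fst p) * (g (fst q) * h (snd q)))"
      by (rule sum.reindex_bij_witness[of _ "\<lambda>((A, BC), (B, C)). ((A + B, C), (A, B))"
            "\<lambda>((AB, C), (A, B)). ((A, B + C), (B, C))"])
        (auto simp: decomps_def mult.assoc add.assoc)
    also have "\<dots> = (\<Sum>(K, L)\<in>decomps N. f K * (\<Sum>(L1, L2)\<in>decomps L. g L1 * h L2))"
      by (simp add: case_prod_beta sum_distrib_left finite_decomps sum.Sigma)
    finally show "(\<Sum>(K, L)\<in>decomps N. (\<Sum>(K1, K2)\<in>decomps K. f K1 * g K2) * h L) =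
      (\<Sum>(K, L)\<in>decomps N. f K * (\<Sum>(L1, L2)\<in>decomps L. g L1 * h L2))" .
  qed
  show "1 * a = a"
  proof (transfer, rule ext)
    fix f :: "('a \<Rightarrow>\<^sub>0 nat) \<Rightarrow> 'b" and N
    have "(\<Sum>p\<in>decomps N. (if fst p = 0 then 1 else 0) * f (snd p)) =
      (\<Sum>p\<in>{(0 :: 'a \<Rightarrow>\<^sub>0 nat, N)}. (if fst p = 0 then 1 else 0) * f (snd p))"
      by (rule sum.mono_neutral_right[OF finite_decomps]) (auto simp: decomps_def)
    then show "(\<Sum>(K, L)\<in>decomps N. (if K = 0 then 1 else 0) * f L) = f N"
      by (simp add: case_prod_beta)
  qed
  show "a * 1 = a"
  proof (transfer, rule ext)
    fix f :: "('a \<Rightarrow>\<^sub>0 nat) \<Rightarrow> 'b" and N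
    have "(\<Sum>p\<in>decomps N. f (fst p) * (if snd p = 0 then 1 else 0)) =
      (\<Sum>p\<in>{(N, 0 :: 'a \<Rightarrow>\<^sub>0 nat)}. f (fst p) * (if snd p = 0 then 1 else 0))"
      by (rule sum.mono_neutral_right[OF finite_decomps]) (auto simp: decomps_def)
    then show "(\<Sum>(K, L)\<in>decomps N. f K * (if L = 0 then 1 else 0)) = f N"
      by (simp add: case_prod_beta)
  qed
  show "0 \<noteq> (1 :: ('a, 'b) mfps)"
    by transfer (metis zero_neq_one)
qed (transfer; simp add: fun_eq_iff algebra_simps case_prod_beta sum.distrib)+
end

definition mmonom :: "('v \<Rightarrow>\<^sub>0 nat) \<Rightarrow> 'a::zero \<Rightarrow> ('v, 'a) mfps" where
  "mmonom M a = Abs_mfps (\<lambda>N. if N = M then a else 0)"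

definition mmap :: "('a \<Rightarrow> 'b) \<Rightarrow> ('v, 'a) mfps \<Rightarrow> ('v, 'b) mfps" where
  "mmap f F = Abs_mfps (\<lambda>N. f (mcoeff F N))"

text \<open>The exponential is meant for series without constant term, the logarithm for series with
  constant term 1. For these the sums over \<open>k\<close> are finite in each degree, as
  \<open>mcoeff_power_eq_0\<close> below shows.\<close>

definition mexp :: "('v, 'a::rat_algebra) mfps \<Rightarrow> ('v, 'a) mfps" where
  "mexp F = Abs_mfps (\<lambda>N. Sum_any (\<lambda>k. (1 / fact k) *\<^sub>Q mcoeff (F ^ k) N))"

definition mlog :: "('v, 'a::rat_algebra) mfps \<Rightarrow> ('v, 'a) mfps" where
  "mlog F = Abs_mfps (\<lambda>N. Sum_any (\<lambda>k. ((- 1) ^ k / of_nat (Suc k)) *\<^sub>Q mcoeff ((F - 1) ^ Suc k) N))"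

lemma mcoeff_power_eq_0:
  assumes "mcoeff F 0 = 0" "(\<Sum>v\<in>Poly_Mapping.keys N. Poly_Mapping.lookup N v) < k"
  shows "mcoeff (F ^ k) N = 0"
  using assms(2)
proof (induction k arbitrary: N)
  case (Suc k)
  let ?d = "\<lambda>N. \<Sum>v\<in>Poly_Mapping.keys N. Poly_Mapping.lookup N v"
  have "mcoeff F K * mcoeff (F ^ k) L = 0" if KL: "(K, L) \<in> decomps N" for K L
  proof (cases "K = 0")
    case False
    then obtain v where "v \<in> Poly_Mapping.keys K" by (metis keys_eq_empty ex_in_conv)
    then have "?d K > 0"
      by (intro sum_pos2[of _ v]) (auto simp: in_keys_iff)
    moreover have "?d N = ?d K + ?d L"
      using KL setsum_keys_plus_distrib[of "\<lambda>_ n. n" K L] by (auto simp: decomps_def)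
    ultimately have "?d L < k" using Suc.prems by linarith
    then show ?thesis by (simp add: Suc.IH)
  qed (simp add: assms(1))
  then show ?case
    by (auto simp: times_mfps.rep_eq intro!: sum.neutral)
qed simp


section \<open>The ring \<open>R\<^sub>\<Gamma>\<close>\<close>

text \<open>The finite group is a type \<open>'g\<close> of class \<open>group_add\<close> (groups that need not be commutative,
  written additively), so that \<open>'g \<Rightarrow>\<^sub>0 rat\<close> with its convolution product is the group algebra.\<close>

definition conjugate :: "'g::group_add \<Rightarrow> 'g \<Rightarrow> bool" where
  "conjugate x y \<longleftrightarrow> (\<exists>h. y = h + x - h)"

lemma equivp_conjugate: "equivp (conjugate :: 'g::group_add \<Rightarrow> 'g \<Rightarrow> bool)"
proof (rule equivpI)
  show "reflp (conjugate :: 'g \<Rightarrow> 'g \<Rightarrow> bool)"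
    by (rule reflpI) (auto simp: conjugate_def intro: exI[of _ 0])
  have "conjugate y x" if xy: "conjugate x y" for x y :: 'g
  proof -
    obtain h where "y = h + x - h" using xy by (auto simp: conjugate_def)
    then have "x = - h + y - (- h)"
      by (simp add: add.assoc diff_conv_add_uminus del: add_uminus_conv_diff)
    then show ?thesis unfolding conjugate_def by (rule exI)
  qed
  then show "symp (conjugate :: 'g \<Rightarrow> 'g \<Rightarrow> bool)" by (rule sympI)
  show "transp (conjugate :: 'g \<Rightarrow> 'g \<Rightarrow> bool)"
  proof (rule transpI)
    fix x y z :: 'g assume "conjugate x y" "conjugate y z"
    then obtain h k where "y = h + x - h" "z = k + y - k" by (auto simp: conjugate_def)
    then have "z = (k + h) + x - (k + h)"
      by (simp add: add.assoc minus_add diff_conv_add_uminus del: add_uminus_conv_diff)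
    then show "conjugate x z" unfolding conjugate_def by blast
  qed
qed

quotient_type (overloaded) 'g conj_class = "'g::group_add" / conjugate
  by (rule equivp_conjugate)

instance conj_class :: ("{group_add, finite}") finite
proof
  have "(UNIV :: 'a conj_class set) = range abs_conj_class"
    by (metis Quotient3_abs_rep Quotient3_conj_class surj_def)
  then show "finite (UNIV :: 'a conj_class set)" by (metis finite finite_imageI)
qed

typedef (overloaded) 'g center = "{z :: 'g::monoid_add \<Rightarrow>\<^sub>0 rat. \<forall>y. z * y = y * z}"
  by (rule exI[of _ 0]) simp

setup_lifting type_definition_center

instantiation center :: (monoid_add) "{comm_ring_1, rat_algebra}"
begin
lift_definition zero_center :: "'a center" is 0 by simp
lift_definition one_center :: "'a center" is 1 by simp
lift_definition plus_center :: "'a center \<Rightarrow> 'a center \<Rightarrow> 'a center" is "(+)"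
  by (simp only: distrib_left distrib_right)
lift_definition minus_center :: "'a center \<Rightarrow> 'a center \<Rightarrow> 'a center" is "(-)"
  by (simp only: left_diff_distrib right_diff_distrib)
lift_definition uminus_center :: "'a center \<Rightarrow> 'a center" is uminus
  by (simp only: minus_mult_left[symmetric] minus_mult_right[symmetric])
lift_definition times_center :: "'a center \<Rightarrow> 'a center \<Rightarrow> 'a center" is "(*)"
proof -
  fix x x' y :: "'a \<Rightarrow>\<^sub>0 rat"
  assume *: "\<And>y. x * y = y * x" "\<And>y. x' * y = y * x'"
  have "x * x' * y = x * (x' * y)" by (rule mult.assoc)
  also have "\<dots> = x * (y * x')" by (simp only: *(2)[of y])
  also have "\<dots> = (x * y) * x'" by (rule mult.assoc[symmetric])
  also have "\<dots> = (y * x) * x'" by (simp only: *(1)[of y])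
  also have "\<dots> = y * (x * x')" by (rule mult.assoc)
  finally show "x * x' * y = y * (x * x')" .
qed
lift_definition scaleQ_center :: "rat \<Rightarrow> 'a center \<Rightarrow> 'a center" is scaleQ
  by (simp only: mult_scaleQ_left mult_scaleQ_right)
instance
proof
  fix x y :: "'a center"
  show "x * y = y * x" by transfer blast
qed (simp_all only: Rep_center_inject[symmetric] zero_center.rep_eq one_center.rep_eq plus_center.rep_eq
    minus_center.rep_eq uminus_center.rep_eq times_center.rep_eq scaleQ_center.rep_eq,
    simp_all add: add.assoc add.commute mult.assoc distrib_left distrib_right scaleQ_add_right
      scaleQ_add_left mult_scaleQ_left mult_scaleQ_right scaleQ_scaleQ)
end

instantiation center :: (monoid_add) rat_lie_algebra
begin
definition bracket_center :: "'a center \<Rightarrow> 'a center \<Rightarrow> 'a center" where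
  "bracket_center x y = 0"
instance by standard (simp_all add: bracket_center_def)
end

definition class_sum :: "'g::{group_add, finite} conj_class \<Rightarrow> 'g center" where
  "class_sum c = Abs_center (\<Sum>x | abs_conj_class x = c. Poly_Mapping.single x 1)"

lemma Rep_class_sum:
  "Rep_center (class_sum c) = (\<Sum>x | abs_conj_class x = c. Poly_Mapping.single x 1)"
proof -
  let ?s = "\<Sum>x | abs_conj_class x = c. Poly_Mapping.single x 1 :: 'a \<Rightarrow>\<^sub>0 rat"
  have conj: "abs_conj_class (h + x - h) = abs_conj_class x" for h x :: 'a
    by (metis Quotient3_rel_abs Quotient3_conj_class conjugate_def)
  have single: "?s * Poly_Mapping.single h a = Poly_Mapping.single h a * ?s" for h a
  proof -
    have "(\<Sum>x | abs_conj_class x = c. Poly_Mapping.single (x + h) a) =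
      (\<Sum>x | abs_conj_class x = c. Poly_Mapping.single (h + x) a)"
      by (rule sum.reindex_bij_witness[of _ "\<lambda>x. h + x - h" "\<lambda>x. - h + x - (- h)"])
        (simp_all only: conj mem_Collect_eq,
          simp_all add: add.assoc minus_add diff_conv_add_uminus del: add_uminus_conv_diff)
    then show ?thesis
      by (simp add: sum_distrib_left sum_distrib_right mult_single)
  qed
  have "?s * y = y * ?s" for y
    by (induction y rule: poly_mapping_add_induct) (simp_all only: single distrib_left distrib_right mult_zero_left mult_zero_right)
  then show ?thesis
    unfolding class_sum_def by (subst Abs_center_inverse) auto
qed

definition B_coeff :: "('g::{group_add, finite} conj_class \<Rightarrow>\<^sub>0 nat) \<Rightarrow> 'g center uea" where
  "B_coeff = mcoeff (mexp (mmap \<iota> (mlog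
     (1 + (\<Sum>c\<in>UNIV. mmonom (Poly_Mapping.single c 1) (class_sum c))))))"

definition R\<^sub>\<Gamma> :: "'g::{group_add, finite} center uea set" where
  "R\<^sub>\<Gamma> = int_mod.span (range B_coeff)"

end

theory Submission
  imports Defs
begin

text \<open>For a series \<open>F\<close> over \<open>\<gg> = Z(\<rat>\<Gamma>)\<close> with constant term 1 put \<open>explog F = exp(T(log F))\<close>. The
  \<open>B_coeff N\<close> are the coefficients of \<open>explog\<close> at the generating series \<open>G(x) = 1 + \<Sum>\<^sub>c c x\<^sub>c\<close>. Each of
  the Hopf algebra axioms becomes an identity between such exponentials.

  Since \<open>\<gg>\<close> is abelian, \<open>\<U>(\<gg>)\<close> is commutative, and the functional equations of \<open>log\<close> and \<open>exp\<close>
  (\<open>mlog_mult\<close>, \<open>mexp_add\<close>) give \<open>explog (F F') = explog F explog F'\<close>. Both equations follow from the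
  Euler derivation, which multiplies the terms of degree \<open>d\<close> by \<open>d\<close>: a series over a rational vector
  space is determined by its Euler derivative and its constant term.

  The arithmetic input is \<open>explog_coeffs_in\<close>: if \<open>F\<close> has constant term 1 and all its coefficients are
  integral combinations of class sums, then \<open>explog F\<close> has coefficients in \<open>R\<^sub>\<Gamma>\<close>. Indeed
  \<open>F = 1 + \<Sum>\<^sub>c c z\<^sub>c\<close> for integral power series \<open>z\<^sub>c\<close> without constant term, so \<open>F\<close> arises from \<open>G\<close> by
  the substitution \<open>x\<^sub>c = z\<^sub>c\<close>. Substitution commutes with \<open>log\<close>, \<open>T\<close> and \<open>exp\<close>, whence
  \<open>explog F = \<Sum>\<^sub>N B\<^sub>N z\<^sup>N\<close>, and the coefficients of \<open>z\<^sup>N\<close> are integers. The integral combinations of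
  class sums are the central elements with integral coefficients in the group basis, hence form
  a ring.

  Products: in two disjoint sets of variables, \<open>B\<^sub>M B\<^sub>N\<close> is the coefficient of \<open>x\<^sup>M y\<^sup>N\<close> in
  \<open>explog (G(x)) explog (G(y)) = explog (G(x) G(y))\<close>. Antipode: it maps \<open>exp(T(log G))\<close> to
  \<open>exp(- T(log G)) = explog (G\<^sup>-\<^sup>1)\<close>, and \<open>G\<^sup>-\<^sup>1\<close> again has integral coefficients. In both cases
  \<open>explog_coeffs_in\<close> applies. Comultiplication and counit: the coefficients of \<open>T(log G)\<close> are
  primitive, so the exponential is group-like, that is \<open>\<Delta>(B\<^sub>N) = \<Sum>\<^bsub>K+L=N\<^esub> B\<^sub>K \<otimes> B\<^sub>L\<close>, and
  \<open>\<epsilon>(B\<^sub>N) = 0\<close> for \<open>N \<noteq> 0\<close>.\<close>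

section \<open>Commutative instances\<close>

text \<open>Commutativity of the enveloping algebra depends on the Lie algebra. As a type class of the
  latter it can be turned into an instance of \<open>comm_ring_1\<close>, so that power series over
  \<open>\<U>(\<gg>)\<close> are commutative as well.\<close>

class abelian_rat_lie_algebra = rat_lie_algebra +
  assumes bracket_eq_0: "bracket x y = 0"

instance center :: (monoid_add) abelian_rat_lie_algebra
  by standard (simp add: bracket_center_def)

lemma uea_induct [case_names \<iota> one add mult scaleQ]:
  fixes u :: "'l::rat_lie_algebra uea"
  assumes "\<And>x. P (\<iota> x)" "P 1" "\<And>u v. P u \<Longrightarrow> P v \<Longrightarrow> P (u + v)"
    "\<And>u v. P u \<Longrightarrow> P v \<Longrightarrow> P (u * v)" "\<And>q u. P u \<Longrightarrow> P (q *\<^sub>Q u)"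
  shows "P u"
proof -
  have word: "P (abs_uea (Poly_Mapping.single (Word w) 1))" for w :: "'l list"
  proof (induction w)
    case Nil
    then show ?case
      using assms(2) by (simp add: one_uea_def flip: single_one zero_word_def)
  next
    case (Cons x w)
    have "Poly_Mapping.single (Word (x # w)) 1 = letter x * Poly_Mapping.single (Word w) (1::rat)"
      by (simp add: mult_single plus_word_def)
    then have "abs_uea (Poly_Mapping.single (Word (x # w)) 1) =
        \<iota> x * abs_uea (Poly_Mapping.single (Word w) 1)"
      by (simp add: \<iota>.abs_eq times_uea.abs_eq)
    then show ?case using assms(1,4) Cons by simp
  qed
  have P0: "P 0" using assms(5)[OF assms(2), of 0] by simp
  have "P (abs_uea p)" for p
  proof (induction p rule: poly_mapping_add_induct)
    case zero then show ?case using P0 by (simp add: zero_uea_def)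
  next
    case (single k c)
    obtain w where "k = Word w" by (cases k)
    then have "abs_uea (Poly_Mapping.single k c) = c *\<^sub>Q abs_uea (Poly_Mapping.single (Word w) 1)"
      by (simp add: scaleQ_uea.abs_eq scaleQ_single scaleQ_rat_def)
    then show ?case using assms(5) word by simp
  next
    case (add f g)
    then show ?case using assms(3) by (simp add: plus_uea.abs_eq[symmetric])
  qed
  then show ?thesis by (metis Quotient3_abs_rep Quotient3_uea)
qed

instance uea :: (abelian_rat_lie_algebra) comm_ring_1
proof
  have gen: "\<iota> x * u = u * \<iota> x" for x :: 'a and u
  proof (induction u rule: uea_induct)
    case (\<iota> y)
    have "\<iota> (0 :: 'a) = 0"
      using \<iota>_simps(2)[of 0 "0 :: 'a"] by simp
    then show ?case using \<iota>_simps(3)[of x y] by (simp add: bracket_eq_0)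
  next
    case (mult u v)
    then show ?case by (metis mult.assoc)
  qed (simp_all add: distrib_left distrib_right mult_scaleQ_left mult_scaleQ_right)
  fix u v :: "'a uea"
  show "u * v = v * u"
  proof (induction u rule: uea_induct)
    case (\<iota> x)
    then show ?case by (rule gen)
  next
    case (mult u w)
    then show ?case by (metis mult.assoc)
  qed (simp_all add: distrib_left distrib_right mult_scaleQ_left mult_scaleQ_right)
qed (simp_all add: distrib_right)

lemma tensor_induct [case_names pure add scaleQ]:
  assumes "\<And>a b. P (a \<otimes>\<^sub>Q b)" "\<And>s t. P s \<Longrightarrow> P t \<Longrightarrow> P (s + t)" "\<And>q t. P t \<Longrightarrow> P (q *\<^sub>Q t)"
  shows "P (t :: ('a::rat_algebra, 'b::rat_algebra) tensor)"
proof -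
  have P0: "P 0" using assms(3)[OF assms(1), of 0] by simp
  have "P (abs_tensor p)" for p
  proof (induction p rule: poly_mapping_add_induct)
    case zero then show ?case using P0 by (simp add: zero_tensor_def)
  next
    case (single k c)
    obtain a b where "k = Pair_of a b" by (cases k)
    then have "abs_tensor (Poly_Mapping.single k c) = c *\<^sub>Q (a \<otimes>\<^sub>Q b)"
      by (simp add: tensor.abs_eq scaleQ_tensor.abs_eq scaleQ_single scaleQ_rat_def)
    then show ?case using assms(1,3) by simp
  next
    case (add f g)
    then show ?case using assms(2) by (simp add: plus_tensor.abs_eq[symmetric])
  qed
  then show ?thesis by (metis Quotient3_abs_rep Quotient3_tensor)
qed

instance tensor :: ("{rat_algebra, comm_ring_1}", "{rat_algebra, comm_ring_1}") comm_ring_1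
proof
  fix s t :: "('a, 'b) tensor"
  have pure: "(a \<otimes>\<^sub>Q b) * t = t * (a \<otimes>\<^sub>Q b)" for a b
    by (induction t rule: tensor_induct)
      (simp_all add: tensor_simps mult.commute distrib_left distrib_right mult_scaleQ_left mult_scaleQ_right)
  show "s * t = t * s"
    by (induction s rule: tensor_induct)
      (simp_all add: pure distrib_left distrib_right mult_scaleQ_left mult_scaleQ_right)
qed (simp_all add: distrib_right)

instance mfps :: (type, comm_ring_1) comm_ring_1
proof
  fix F G :: "('a, 'b) mfps"
  show "F * G = G * F"
    by (rule mfps_eqI, unfold times_mfps.rep_eq,
        rule sum.reindex_bij_witness[of _ prod.swap prod.swap])
      (auto simp: decomps_def add.commute mult.commute)
qed (simp_all add: distrib_right)

instantiation mfps :: (type, rat_algebra) rat_algebra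
begin
lift_definition scaleQ_mfps :: "rat \<Rightarrow> ('a, 'b) mfps \<Rightarrow> ('a, 'b) mfps" is "\<lambda>q F N. q *\<^sub>Q F N" .
instance
  by standard (transfer; simp add: fun_eq_iff scaleQ_add_right scaleQ_add_left scaleQ_scaleQ scaleQ_one
      mult_scaleQ_left mult_scaleQ_right rat_vec.scale_sum_right case_prod_beta)+
end


section \<open>Truncation of power series\<close>

lemma mcoeff_simps [simp]:
  "mcoeff 0 N = 0" "mcoeff (F + G) N = mcoeff F N + mcoeff G N"
  "mcoeff (F - G) N = mcoeff F N - mcoeff G N" "mcoeff (- F) N = - mcoeff F N"
  "mcoeff (q *\<^sub>Q H) N = q *\<^sub>Q mcoeff H N" "mcoeff (mmap f K) N = f (mcoeff K N)"
  by (simp_all add: zero_mfps.rep_eq plus_mfps.rep_eq minus_mfps.rep_eq uminus_mfps.rep_eq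
      scaleQ_mfps.rep_eq mmap_def Abs_mfps_inverse)

lemma mcoeff_1: "mcoeff 1 N = (if N = 0 then 1 else 0)"
  by (simp add: one_mfps.rep_eq)

lemma mcoeff_mult: "mcoeff (F * G) N = (\<Sum>(K, L)\<in>decomps N. mcoeff F K * mcoeff G L)"
  by (simp add: times_mfps.rep_eq)

lemma mcoeff_sum: "mcoeff (\<Sum>i\<in>A. F i) N = (\<Sum>i\<in>A. mcoeff (F i) N)"
  by (induction A rule: infinite_finite_induct) simp_all

lemma mcoeff_mmonom: "mcoeff (mmonom M a) N = (if N = M then a else 0)"
  by (simp add: mmonom_def Abs_mfps_inverse)

definition mdeg :: "('v \<Rightarrow>\<^sub>0 nat) \<Rightarrow> nat" where
  "mdeg N = (\<Sum>v\<in>Poly_Mapping.keys N. Poly_Mapping.lookup N v)"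

lemma mdeg_add: "mdeg (K + L) = mdeg K + mdeg L"
  using setsum_keys_plus_distrib[of "\<lambda>_ n. n" K L] by (simp add: mdeg_def)

lemma mdeg_decomps: "(K, L) \<in> decomps N \<Longrightarrow> mdeg N = mdeg K + mdeg L"
  by (auto simp: decomps_def mdeg_add)

lemma mdeg_0 [simp]: "mdeg 0 = 0"
  by (simp add: mdeg_def)

lemma mdeg_eq_0_iff: "mdeg N = 0 \<longleftrightarrow> N = 0"
proof
  assume *: "mdeg N = 0"
  show "N = 0"
    by (rule poly_mapping_eqI) (use * in \<open>auto simp: mdeg_def in_keys_iff\<close>)
qed simp

lemma decomps_0: "decomps 0 = {(0, 0)}"
proof -
  have "K + L = 0 \<longleftrightarrow> K = 0 \<and> L = 0" for K L :: "'a \<Rightarrow>\<^sub>0 nat"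
    by (metis add_is_0 mdeg_add mdeg_eq_0_iff)
  then show ?thesis by (auto simp: decomps_def)
qed

lemma mcoeff_mult_0: "mcoeff (F * G) 0 = mcoeff F 0 * mcoeff G 0"
  by (simp add: mcoeff_mult decomps_0)

definition vanishes_below :: "nat \<Rightarrow> ('v, 'a::zero) mfps \<Rightarrow> bool" where
  "vanishes_below d F \<longleftrightarrow> (\<forall>N. mdeg N < d \<longrightarrow> mcoeff F N = 0)"

lemma vanishes_below_0: "vanishes_below 0 F"
  by (simp add: vanishes_below_def)

lemma vanishes_below_1_iff: "vanishes_below (Suc 0) F \<longleftrightarrow> mcoeff F 0 = 0"
  by (auto simp: vanishes_below_def mdeg_eq_0_iff)

lemma vanishes_below_mult:
  fixes F G :: "('v, 'a::ring_1) mfps"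
  assumes "vanishes_below d F" "vanishes_below e G"
  shows "vanishes_below (d + e) (F * G)"
  unfolding vanishes_below_def
proof (intro allI impI)
  fix N :: "'v \<Rightarrow>\<^sub>0 nat" assume N: "mdeg N < d + e"
  have "mcoeff F K * mcoeff G L = 0" if "(K, L) \<in> decomps N" for K L
  proof -
    have "mdeg K < d \<or> mdeg L < e" using mdeg_decomps[OF that] N by linarith
    then show ?thesis using assms by (auto simp: vanishes_below_def)
  qed
  then show "mcoeff (F * G) N = 0"
    by (auto simp: mcoeff_mult intro!: sum.neutral)
qed

lemma vanishes_below_power: "vanishes_below d F \<Longrightarrow> vanishes_below (k * d) (F ^ k)"
  by (induction k) (auto simp: vanishes_below_0 intro: vanishes_below_mult)

lemma vanishes_below_prod:
  "(\<And>i. i \<in> A \<Longrightarrow> vanishes_below (d i) (F i)) \<Longrightarrow> vanishes_below (\<Sum>i\<in>A. d i) (\<Prod>i\<in>A. F i :: ('v, 'a::comm_ring_1) mfps)"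
  by (induction A rule: infinite_finite_induct) (auto simp: vanishes_below_0 intro: vanishes_below_mult)

text \<open>Congruence modulo the series of order greater than \<open>n\<close>. The exponential, the logarithm and
  the inverse are congruent to polynomial expressions, so identities between them can be checked
  on finite sums, one \<open>n\<close> at a time.\<close>

definition eq_upto :: "nat \<Rightarrow> ('v, 'a) mfps \<Rightarrow> ('v, 'a) mfps \<Rightarrow> bool" where
  "eq_upto n F G \<longleftrightarrow> (\<forall>N. mdeg N \<le> n \<longrightarrow> mcoeff F N = mcoeff G N)"

lemma eq_upto_refl: "eq_upto n F F"
  by (simp add: eq_upto_def)

lemma eq_upto_sym: "eq_upto n F G \<Longrightarrow> eq_upto n G F"
  by (simp add: eq_upto_def)

lemma eq_upto_trans [trans]: "eq_upto n F G \<Longrightarrow> eq_upto n G H \<Longrightarrow> eq_upto n F H"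
  by (simp add: eq_upto_def)

lemma eq_upto_mono: "eq_upto n F G \<Longrightarrow> m \<le> n \<Longrightarrow> eq_upto m F G"
  by (simp add: eq_upto_def)

lemma eq_upto_0D: "eq_upto n F G \<Longrightarrow> mcoeff F 0 = mcoeff G 0"
  by (simp add: eq_upto_def)

lemma eq_upto_ext: "(\<And>n. eq_upto n F G) \<Longrightarrow> F = G"
  unfolding eq_upto_def by (intro mfps_eqI) blast

lemma eq_upto_mult:
  assumes "eq_upto n F F'" "eq_upto n G G'"
  shows "eq_upto n (F * G) (F' * G')"
proof -
  have "mcoeff F K * mcoeff G L = mcoeff F' K * mcoeff G' L"
    if "mdeg N \<le> n" "(K, L) \<in> decomps N" for N K L
    using assms mdeg_decomps[OF that(2)] that(1) by (simp add: eq_upto_def)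
  then show ?thesis
    unfolding eq_upto_def by (auto simp: mcoeff_mult intro!: sum.cong)
qed

lemma eq_upto_diff_vanishing: "vanishes_below (Suc n) G \<Longrightarrow> eq_upto n (F - G) F"
  by (simp add: eq_upto_def vanishes_below_def)

lemma eq_upto_mexp:
  fixes F :: "('v, 'a::rat_algebra) mfps"
  assumes "mcoeff F 0 = 0"
  shows "eq_upto n (mexp F) (\<Sum>k\<le>n. (1 / fact k) *\<^sub>Q F ^ k)"
  unfolding eq_upto_def
proof (intro allI impI)
  fix N :: "'v \<Rightarrow>\<^sub>0 nat" assume "mdeg N \<le> n"
  then have *: "mcoeff (F ^ k) N = 0" if "k \<notin> {..n}" for k
    using mcoeff_power_eq_0[OF assms, of N k] that by (simp add: mdeg_def)
  have "Sum_any (\<lambda>k. (1 / fact k) *\<^sub>Q mcoeff (F ^ k) N) = (\<Sum>k\<le>n. (1 / fact k) *\<^sub>Q mcoeff (F ^ k) N)"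
    by (rule Sum_any.expand_superset) (use * in auto)
  then show "mcoeff (mexp F) N = mcoeff (\<Sum>k\<le>n. (1 / fact k) *\<^sub>Q F ^ k) N"
    by (simp add: mexp_def Abs_mfps_inverse mcoeff_sum)
qed

lemma eq_upto_mlog:
  fixes F :: "('v, 'a::rat_algebra) mfps"
  assumes "mcoeff F 0 = 1"
  shows "eq_upto n (mlog F) (\<Sum>k<n. ((- 1) ^ k / of_nat (Suc k)) *\<^sub>Q (F - 1) ^ Suc k)"
  unfolding eq_upto_def
proof (intro allI impI)
  fix N :: "'v \<Rightarrow>\<^sub>0 nat" assume "mdeg N \<le> n"
  moreover have "mcoeff (F - 1) 0 = 0" using assms by (simp add: mcoeff_1)
  ultimately have *: "mcoeff ((F - 1) ^ Suc k) N = 0" if "k \<notin> {..<n}" for k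
    using mcoeff_power_eq_0[of "F - 1" N "Suc k"] that by (simp add: mdeg_def)
  have "Sum_any (\<lambda>k. ((- 1) ^ k / of_nat (Suc k)) *\<^sub>Q mcoeff ((F - 1) ^ Suc k) N) =
      (\<Sum>k<n. ((- 1) ^ k / of_nat (Suc k)) *\<^sub>Q mcoeff ((F - 1) ^ Suc k) N)"
    by (rule Sum_any.expand_superset) (use * in \<open>auto simp del: power_Suc of_nat_Suc\<close>)
  then show "mcoeff (mlog F) N = mcoeff (\<Sum>k<n. ((- 1) ^ k / of_nat (Suc k)) *\<^sub>Q (F - 1) ^ Suc k) N"
    by (simp add: mlog_def Abs_mfps_inverse mcoeff_sum del: power_Suc)
qed

lemma mcoeff_mexp_0: "mcoeff F 0 = 0 \<Longrightarrow> mcoeff (mexp F) 0 = 1"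
  using eq_upto_0D[OF eq_upto_mexp[of F 0]] by (simp add: mcoeff_1 scaleQ_one)

lemma mcoeff_mlog_0: "mcoeff F 0 = 1 \<Longrightarrow> mcoeff (mlog F) 0 = 0"
  using eq_upto_0D[OF eq_upto_mlog[of F 0]] by simp

text \<open>The geometric series \<open>\<Sum>\<^sub>k (1 - F)\<^sup>k\<close>. For constant term 1 the powers above the degree of \<open>N\<close> do not
  reach the coefficient at \<open>N\<close>.\<close>

definition minv :: "('v, 'a::ring_1) mfps \<Rightarrow> ('v, 'a) mfps" where
  "minv F = Abs_mfps (\<lambda>N. mcoeff (\<Sum>k\<le>mdeg N. (1 - F) ^ k) N)"

lemma eq_upto_minv:
  fixes F :: "('v, 'a::ring_1) mfps"
  assumes "mcoeff F 0 = 1"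
  shows "eq_upto n (minv F) (\<Sum>k\<le>n. (1 - F) ^ k)"
  unfolding eq_upto_def
proof (intro allI impI)
  fix N :: "'v \<Rightarrow>\<^sub>0 nat" assume N: "mdeg N \<le> n"
  have "mcoeff (1 - F) 0 = 0" using assms by (simp add: mcoeff_1)
  then have "mcoeff ((1 - F) ^ k) N = 0" if "mdeg N < k" for k
    using mcoeff_power_eq_0[of "1 - F" N k] that by (simp add: mdeg_def)
  then have "(\<Sum>k\<le>mdeg N. mcoeff ((1 - F) ^ k) N) = (\<Sum>k\<le>n. mcoeff ((1 - F) ^ k) N)"
    using N by (intro sum.mono_neutral_left) auto
  then show "mcoeff (minv F) N = mcoeff (\<Sum>k\<le>n. (1 - F) ^ k) N"
    by (simp add: minv_def Abs_mfps_inverse mcoeff_sum)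
qed

lemma mcoeff_minv_0: "mcoeff F 0 = 1 \<Longrightarrow> mcoeff (minv F) 0 = 1"
  by (simp add: minv_def Abs_mfps_inverse mcoeff_1)

lemma minv_right:
  fixes F :: "('v, 'a::comm_ring_1) mfps"
  assumes "mcoeff F 0 = 1"
  shows "F * minv F = 1"
proof (rule eq_upto_ext)
  fix n
  have "mcoeff (1 - F) 0 = 0" using assms by (simp add: mcoeff_1)
  then have van: "vanishes_below (Suc n) ((1 - F) ^ Suc n)"
    using vanishes_below_power[of "Suc 0" "1 - F" "Suc n"] by (simp add: vanishes_below_1_iff del: power_Suc)
  have "F * (\<Sum>k\<le>n. (1 - F) ^ k) = 1 - (1 - F) ^ Suc n"
    using one_diff_power_eq[of "1 - F" "Suc n"] by (simp add: lessThan_Suc_atMost)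
  then show "eq_upto n (F * minv F) 1"
    using eq_upto_mult[OF eq_upto_refl eq_upto_minv[OF assms]] eq_upto_diff_vanishing[OF van]
    by (metis eq_upto_trans)
qed


section \<open>Functional equations of exponential and logarithm\<close>

text \<open>The derivation \<open>\<Sum>\<^sub>v x\<^sub>v \<partial>/\<partial>x\<^sub>v\<close>. A single derivation suffices for all variables because it
  is injective on series without constant term.\<close>

definition euler :: "('v, 'a::rat_algebra) mfps \<Rightarrow> ('v, 'a) mfps" where
  "euler F = Abs_mfps (\<lambda>N. of_nat (mdeg N) *\<^sub>Q mcoeff F N)"

lemma mcoeff_euler [simp]: "mcoeff (euler F) N = of_nat (mdeg N) *\<^sub>Q mcoeff F N"
  by (simp add: euler_def Abs_mfps_inverse)

lemma euler_add: "euler (F + G) = euler F + euler G"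
  by (rule mfps_eqI) (simp add: scaleQ_add_right)

lemma euler_diff: "euler (F - G) = euler F - euler G"
  by (rule mfps_eqI) (simp add: rat_vec.scale_right_diff_distrib)

lemma euler_1 [simp]: "euler 1 = 0"
  by (rule mfps_eqI) (simp add: mcoeff_1)

lemma euler_scaleQ: "euler (q *\<^sub>Q F) = q *\<^sub>Q euler F"
  by (rule mfps_eqI) (simp add: scaleQ_scaleQ mult.commute)

lemma euler_sum: "euler (\<Sum>i\<in>A. F i) = (\<Sum>i\<in>A. euler (F i))"
proof -
  have "euler 0 = (0 :: ('a, 'b) mfps)" by (rule mfps_eqI) simp
  then show ?thesis by (induction A rule: infinite_finite_induct) (simp_all add: euler_add)
qed

lemma euler_mult: "euler (F * G) = euler F * G + F * euler G"
proof (rule mfps_eqI)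
  fix N
  have "of_nat (mdeg N) *\<^sub>Q (mcoeff F K * mcoeff G L) =
      mcoeff (euler F) K * mcoeff G L + mcoeff F K * mcoeff (euler G) L" if "(K, L) \<in> decomps N" for K L
    by (simp add: mdeg_decomps[OF that] mult_scaleQ_left mult_scaleQ_right scaleQ_add_left)
  then show "mcoeff (euler (F * G)) N = mcoeff (euler F * G + F * euler G) N"
    by (simp add: mcoeff_mult rat_vec.scale_sum_right case_prod_beta sum.distrib[symmetric] del: mcoeff_euler)
      (simp add: mcoeff_mult rat_vec.scale_sum_right case_prod_beta sum.distrib[symmetric] cong: sum.cong)
qed

lemma euler_power:
  fixes F :: "('v, 'a::{comm_ring_1, rat_algebra}) mfps"
  shows "euler (F ^ Suc k) = of_nat (Suc k) *\<^sub>Q (F ^ k * euler F)"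
proof (induction k)
  case 0
  then show ?case by (simp add: scaleQ_one)
next
  case (Suc k)
  have "euler (F ^ Suc (Suc k)) = F ^ Suc k * euler F + F * euler (F ^ Suc k)"
    by (simp only: power_Suc[of F "Suc k"] euler_mult mult.commute[of "euler F"])
  also have "\<dots> = of_nat (Suc (Suc k)) *\<^sub>Q (F ^ Suc k * euler F)"
    unfolding Suc of_nat_Suc[of "Suc k"]
    by (simp add: mult_scaleQ_right scaleQ_add_left scaleQ_one mult.assoc del: of_nat_Suc)
  finally show ?case .
qed

lemma eq_upto_euler: "eq_upto n F G \<Longrightarrow> eq_upto n (euler F) (euler G)"
  by (simp add: eq_upto_def)

text \<open>The \<open>k\<close>-th summand of \<open>exp F\<close> has the derivative \<open>F\<^sup>k\<^sup>-\<^sup>1 euler F / (k-1)!\<close>. One summand more is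
  kept on the left, as differentiation shifts the index.\<close>

lemma euler_mexp:
  fixes F :: "('v, 'a::{comm_ring_1, rat_algebra}) mfps"
  assumes "mcoeff F 0 = 0"
  shows "euler (mexp F) = mexp F * euler F"
proof (rule eq_upto_ext)
  fix n
  have "eq_upto n (euler (mexp F)) (euler (\<Sum>k\<le>Suc n. (1 / fact k) *\<^sub>Q F ^ k))"
    by (rule eq_upto_mono[OF eq_upto_euler[OF eq_upto_mexp[OF assms]]]) simp
  also have "euler (\<Sum>k\<le>Suc n. (1 / fact k) *\<^sub>Q F ^ k) = (\<Sum>k\<le>n. (1 / fact (Suc k)) *\<^sub>Q euler (F ^ Suc k))"
    by (simp add: sum.atMost_Suc_shift euler_add euler_sum euler_scaleQ
        del: sum.atMost_Suc power_Suc fact_Suc)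
  also have "\<dots> = (\<Sum>k\<le>n. (1 / fact k) *\<^sub>Q F ^ k) * euler F"
  proof -
    have "1 / fact (Suc k) * of_nat (Suc k) = (1 / fact k :: rat)" for k
      by (simp add: divide_simps)
    then show ?thesis
      by (simp add: euler_power scaleQ_scaleQ sum_distrib_right mult_scaleQ_left
          del: power_Suc of_nat_Suc fact_Suc)
  qed
  also have "eq_upto n \<dots> (mexp F * euler F)"
    by (intro eq_upto_mult eq_upto_refl eq_upto_sym[OF eq_upto_mexp[OF assms]])
  finally show "eq_upto n (euler (mexp F)) (mexp F * euler F)" .
qed

text \<open>With \<open>F = 1 + X\<close> the derivative of the logarithm is a geometric series in \<open>- X\<close> times \<open>euler F\<close>,
  and multiplication by \<open>F\<close> makes it telescope.\<close>

lemma euler_mlog: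
  fixes F :: "('v, 'a::{comm_ring_1, rat_algebra}) mfps"
  assumes "mcoeff F 0 = 1"
  shows "F * euler (mlog F) = euler F"
proof (rule eq_upto_ext)
  fix n
  define X where "X = F - 1"
  have F: "F = 1 + X" and X0: "mcoeff X 0 = 0" using assms by (simp_all add: X_def mcoeff_1)
  have "vanishes_below (Suc n * Suc 0 + 0) ((- X) ^ Suc n * euler X)"
    using X0 by (intro vanishes_below_mult vanishes_below_power vanishes_below_0) (simp add: vanishes_below_1_iff)
  then have van: "vanishes_below (Suc n) ((- X) ^ Suc n * euler X)" by (simp del: power_Suc)
  have eX: "euler F = euler X" by (simp add: F euler_add)
  have "eq_upto n (F * euler (mlog F)) (F * euler (\<Sum>k<Suc n. ((- 1) ^ k / of_nat (Suc k)) *\<^sub>Q X ^ Suc k))"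
    unfolding X_def
    by (intro eq_upto_mult eq_upto_refl, rule eq_upto_mono[OF eq_upto_euler[OF eq_upto_mlog[OF assms]]]) simp
  also have "euler (\<Sum>k<Suc n. ((- 1) ^ k / of_nat (Suc k)) *\<^sub>Q X ^ Suc k) = (\<Sum>k<Suc n. (- 1) ^ k *\<^sub>Q X ^ k) * euler X"
    by (simp add: euler_sum euler_scaleQ euler_power scaleQ_scaleQ sum_distrib_right mult_scaleQ_left
        del: power_Suc of_nat_Suc sum.lessThan_Suc)
  also have "(\<Sum>k<Suc n. (- 1) ^ k *\<^sub>Q X ^ k) = (\<Sum>k<Suc n. (- X) ^ k)"
  proof (rule sum.cong)
    fix k
    show "(- 1) ^ k *\<^sub>Q X ^ k = (- X) ^ k"
      by (cases "even k") (simp_all add: scaleQ_one)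
  qed simp
  also have "F * ((\<Sum>k<Suc n. (- X) ^ k) * euler X) = (F * (\<Sum>k<Suc n. (- X) ^ k)) * euler X"
    by (rule mult.assoc[symmetric])
  also have "F * (\<Sum>k<Suc n. (- X) ^ k) = 1 - (- X) ^ Suc n"
    using one_diff_power_eq[of "- X" "Suc n"] by (simp only: F diff_minus_eq_add)
  also have "(1 - (- X) ^ Suc n) * euler X = euler X - (- X) ^ Suc n * euler X"
    by (simp only: left_diff_distrib mult_1)
  also have "eq_upto n \<dots> (euler F)"
    unfolding eX by (rule eq_upto_diff_vanishing[OF van])
  finally show "eq_upto n (F * euler (mlog F)) (euler F)" .
qed

text \<open>In degree \<open>d > 0\<close> the equation expresses \<open>d\<close> times a coefficient of \<open>Y\<close> by coefficients of lower
  degree, because \<open>C\<close> has no constant term; and \<open>d\<close> is invertible.\<close>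

lemma euler_ode_unique:
  fixes Y C :: "('v, 'a::rat_algebra) mfps"
  assumes "euler Y = Y * C" "mcoeff C 0 = 0" "mcoeff Y 0 = 0"
  shows "Y = 0"
proof -
  have "mcoeff Y N = 0" for N
  proof (induction "mdeg N" arbitrary: N rule: less_induct)
    case less
    show ?case
    proof (cases "N = 0")
      case False
      then have deg: "mdeg N \<noteq> 0" by (simp add: mdeg_eq_0_iff)
      have "mcoeff Y K * mcoeff C L = 0" if "(K, L) \<in> decomps N" for K L
      proof (cases "L = 0")
        case False
        then have "mdeg K < mdeg N" using mdeg_decomps[OF that] by (metis mdeg_eq_0_iff less_add_same_cancel1 neq0_conv)
        then show ?thesis using less by simp
      qed (simp add: assms)
      then have "mcoeff (Y * C) N = 0" by (auto simp: mcoeff_mult intro!: sum.neutral)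
      then have "of_nat (mdeg N) *\<^sub>Q mcoeff Y N = 0" by (simp flip: assms(1))
      then show ?thesis using deg by (simp add: rat_vec.scale_eq_0_iff)
    qed (simp add: assms)
  qed
  then show ?thesis by (intro mfps_eqI) simp
qed

text \<open>Both sides solve \<open>euler Y = Y (euler F + euler G)\<close> with constant term 1.\<close>

lemma mexp_add:
  fixes F G :: "('v, 'a::{comm_ring_1, rat_algebra}) mfps"
  assumes "mcoeff F 0 = 0" "mcoeff G 0 = 0"
  shows "mexp (F + G) = mexp F * mexp G"
proof -
  have "mexp (F + G) - mexp F * mexp G = 0"
  proof (rule euler_ode_unique)
    show "euler (mexp (F + G) - mexp F * mexp G) = (mexp (F + G) - mexp F * mexp G) * (euler F + euler G)"
      using assms by (simp add: euler_diff euler_mexp euler_mult euler_add algebra_simps)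
  qed (use assms in \<open>simp_all add: mcoeff_mexp_0 mcoeff_mult_0\<close>)
  then show ?thesis by simp
qed

text \<open>Both sides have the same Euler derivative \<open>euler F / F + euler G / G\<close>.\<close>

lemma mlog_mult:
  fixes F G :: "('v, 'a::{comm_ring_1, rat_algebra}) mfps"
  assumes F: "mcoeff F 0 = 1" and G: "mcoeff G 0 = 1"
  shows "mlog (F * G) = mlog F + mlog G"
proof -
  define Y where "Y = mlog (F * G) - (mlog F + mlog G)"
  have FG: "mcoeff (F * G) 0 = 1" using assms by (simp add: mcoeff_mult_0)
  have "F * G * euler Y = F * G * euler (mlog (F * G)) - (F * euler (mlog F)) * G - F * (G * euler (mlog G))"
    by (simp add: Y_def euler_diff euler_add algebra_simps)
  also have "\<dots> = 0"
    unfolding euler_mlog[OF F] euler_mlog[OF G] euler_mlog[OF FG] by (simp add: euler_mult)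
  finally have *: "F * G * euler Y = 0" .
  \<comment> \<open>Coefficients may be zero divisors, but a series with constant term 1 can be cancelled.\<close>
  have "euler Y = minv (F * G) * (F * G * euler Y)"
    using minv_right[OF FG] by (metis mult.assoc mult.commute mult_1)
  also have "\<dots> = Y * 0" unfolding * by simp
  finally have "euler Y = Y * 0" .
  moreover have "mcoeff Y 0 = 0" using F G FG by (simp add: Y_def mcoeff_mlog_0)
  ultimately have "Y = 0" by (intro euler_ode_unique[of Y 0]) auto
  then show ?thesis by (simp add: Y_def)
qed


section \<open>Filtered homomorphisms\<close>

global_interpretation rat_lin: vector_space_pair "scaleQ :: rat \<Rightarrow> 'a \<Rightarrow> 'a::rat_vector"
    "scaleQ :: rat \<Rightarrow> 'b \<Rightarrow> 'b::rat_vector" ..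

abbreviation rat_linear :: "('a::rat_vector \<Rightarrow> 'b::rat_vector) \<Rightarrow> bool" where
  "rat_linear \<equiv> Vector_Spaces.linear scaleQ scaleQ"

lemma rat_linearI:
  "(\<And>x y. f (x + y) = f x + f y) \<Longrightarrow> (\<And>q x. f (q *\<^sub>Q x) = q *\<^sub>Q f x) \<Longrightarrow> rat_linear f"
  by (simp add: Vector_Spaces.linear_iff rat_vec.vector_space_axioms)

definition rat_alg_hom :: "('a::rat_algebra \<Rightarrow> 'b::rat_algebra) \<Rightarrow> bool" where
  "rat_alg_hom f \<longleftrightarrow> rat_linear f \<and> f 1 = 1 \<and> (\<forall>x y. f (x * y) = f x * f y)"

lemma rat_alg_homI:
  "(\<And>x y. f (x + y) = f x + f y) \<Longrightarrow> (\<And>q x. f (q *\<^sub>Q x) = q *\<^sub>Q f x) \<Longrightarrow> f 1 = 1 \<Longrightarrow>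
    (\<And>x y. f (x * y) = f x * f y) \<Longrightarrow> rat_alg_hom f"
  by (simp add: rat_alg_hom_def rat_linearI)

lemma rat_alg_hom_power: "rat_alg_hom f \<Longrightarrow> f (x ^ k) = f x ^ k"
  by (induction k) (simp_all add: rat_alg_hom_def)

lemma rat_alg_hom_uea_lift: "lie_hom f \<Longrightarrow> rat_alg_hom (uea_lift f)"
  by (rule rat_alg_homI) (simp_all add: uea_lift)

lemma rat_linear_mmap: "rat_linear f \<Longrightarrow> rat_linear (mmap f)"
  by (rule rat_linearI; rule mfps_eqI) (simp_all add: rat_lin.linear_add rat_lin.linear_scale)

lemma rat_alg_hom_mmap:
  assumes "rat_alg_hom f"
  shows "rat_alg_hom (mmap f)"
proof -
  have f: "rat_linear f" "f 1 = 1" "\<And>x y. f (x * y) = f x * f y"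
    using assms by (simp_all add: rat_alg_hom_def)
  have "mmap f 1 = 1"
    by (rule mfps_eqI) (simp add: mcoeff_1 f(2) rat_lin.linear_0[OF f(1)])
  moreover have "mmap f (F * G) = mmap f F * mmap f G" for F G :: "('c, 'a) mfps"
    by (rule mfps_eqI) (simp add: mcoeff_mult case_prod_beta rat_lin.linear_sum[OF f(1)] f(3))
  ultimately show ?thesis
    using rat_linear_mmap[OF f(1)] by (simp add: rat_alg_hom_def)
qed

text \<open>Algebra homomorphisms between rings of power series that respect truncation commute with
  \<open>mexp\<close> and \<open>mlog\<close>. This covers both homomorphisms applied coefficientwise and substitutions.\<close>

definition filtered :: "(('v, 'a) mfps \<Rightarrow> ('w, 'b) mfps) \<Rightarrow> bool" where
  "filtered \<Phi> \<longleftrightarrow> (\<forall>n F G. eq_upto n F G \<longrightarrow> eq_upto n (\<Phi> F) (\<Phi> G))"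

lemma filtered_mmap: "filtered (mmap f)"
  by (simp add: filtered_def eq_upto_def)

lemma filtered_mexp:
  assumes hom: "rat_alg_hom \<Phi>" and filt: "filtered \<Phi>" and F: "mcoeff F 0 = 0"
  shows "\<Phi> (mexp F) = mexp (\<Phi> F)"
proof (rule eq_upto_ext)
  fix n
  have lin: "rat_linear \<Phi>" using hom by (simp add: rat_alg_hom_def)
  have "eq_upto 0 F 0" using F by (simp add: eq_upto_def mdeg_eq_0_iff)
  then have "eq_upto 0 (\<Phi> F) 0"
    using filt rat_lin.linear_0[OF lin] by (metis filtered_def)
  then have \<Phi>F: "mcoeff (\<Phi> F) 0 = 0" by (auto dest: eq_upto_0D)
  have "eq_upto n (\<Phi> (mexp F)) (\<Phi> (\<Sum>k\<le>n. (1 / fact k) *\<^sub>Q F ^ k))"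
    using filt eq_upto_mexp[OF F] by (simp add: filtered_def)
  also have "\<Phi> (\<Sum>k\<le>n. (1 / fact k) *\<^sub>Q F ^ k) = (\<Sum>k\<le>n. (1 / fact k) *\<^sub>Q \<Phi> F ^ k)"
    by (simp add: rat_lin.linear_sum[OF lin] rat_lin.linear_scale[OF lin] rat_alg_hom_power[OF hom]
        del: sum.atMost_Suc)
  also have "eq_upto n \<dots> (mexp (\<Phi> F))"
    by (rule eq_upto_sym[OF eq_upto_mexp[OF \<Phi>F]])
  finally show "eq_upto n (\<Phi> (mexp F)) (mexp (\<Phi> F))" .
qed

lemma filtered_mlog:
  assumes hom: "rat_alg_hom \<Phi>" and filt: "filtered \<Phi>" and F: "mcoeff F 0 = 1"
  shows "\<Phi> (mlog F) = mlog (\<Phi> F)"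
proof (rule eq_upto_ext)
  fix n
  have lin: "rat_linear \<Phi>" and one: "\<Phi> 1 = 1" using hom by (simp_all add: rat_alg_hom_def)
  have "eq_upto 0 F 1" using F by (simp add: eq_upto_def mdeg_eq_0_iff mcoeff_1)
  then have "eq_upto 0 (\<Phi> F) 1"
    using filt one by (metis filtered_def)
  then have \<Phi>F: "mcoeff (\<Phi> F) 0 = 1" by (auto dest: eq_upto_0D simp: mcoeff_1)
  have diff: "\<Phi> (F - 1) = \<Phi> F - 1" using rat_lin.linear_diff[OF lin] one by simp
  have "eq_upto n (\<Phi> (mlog F)) (\<Phi> (\<Sum>k<n. ((- 1) ^ k / of_nat (Suc k)) *\<^sub>Q (F - 1) ^ Suc k))"
    using filt eq_upto_mlog[OF F] by (simp only: filtered_def)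
  also have "\<Phi> (\<Sum>k<n. ((- 1) ^ k / of_nat (Suc k)) *\<^sub>Q (F - 1) ^ Suc k) =
      (\<Sum>k<n. ((- 1) ^ k / of_nat (Suc k)) *\<^sub>Q (\<Phi> F - 1) ^ Suc k)"
    by (simp only: rat_lin.linear_sum[OF lin] rat_lin.linear_scale[OF lin] rat_alg_hom_power[OF hom] diff)
  also have "eq_upto n \<dots> (mlog (\<Phi> F))"
    by (rule eq_upto_sym[OF eq_upto_mlog[OF \<Phi>F]])
  finally show "eq_upto n (\<Phi> (mlog F)) (mlog (\<Phi> F))" .
qed


section \<open>Substitution\<close>

text \<open>The power product \<open>z\<^sup>N\<close>.\<close>

definition mpow :: "('v::finite \<Rightarrow> ('w, 'a::comm_ring_1) mfps) \<Rightarrow> ('v \<Rightarrow>\<^sub>0 nat) \<Rightarrow> ('w, 'a) mfps" where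
  "mpow z N = (\<Prod>v\<in>UNIV. z v ^ Poly_Mapping.lookup N v)"

text \<open>The substitution \<open>F(z) = \<Sum>\<^sub>N F\<^sub>N z\<^sup>N\<close>. When the \<open>z\<^sub>v\<close> have no constant term, \<open>z\<^sup>N\<close> has no terms of
  degree below that of \<open>N\<close>; the sum is therefore cut off there to make it finite.\<close>

definition msubst :: "('v::finite \<Rightarrow> ('w, rat) mfps) \<Rightarrow> ('v, 'a::rat_vector) mfps \<Rightarrow> ('w, 'a) mfps" where
  "msubst z F = Abs_mfps (\<lambda>M. \<Sum>N | mdeg N \<le> mdeg M. mcoeff (mpow z N) M *\<^sub>Q mcoeff F N)"

lemma mcoeff_msubst:
  "mcoeff (msubst z F) M = (\<Sum>N | mdeg N \<le> mdeg M. mcoeff (mpow z N) M *\<^sub>Q mcoeff F N)"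
  by (simp add: msubst_def Abs_mfps_inverse)

lemma mpow_0 [simp]: "mpow z 0 = 1"
  by (simp add: mpow_def)

lemma mpow_add: "mpow z (K + L) = mpow z K * mpow z L"
  by (simp add: mpow_def lookup_add power_add prod.distrib)

lemma mpow_single: "mpow z (Poly_Mapping.single v k) = z v ^ k"
proof -
  have "z w ^ Poly_Mapping.lookup (Poly_Mapping.single v k) w = (if w = v then z v ^ k else 1)" for w
    by (simp add: lookup_single when_def)
  then show ?thesis by (simp add: mpow_def)
qed

lemma mdeg_UNIV: "mdeg (N :: 'v::finite \<Rightarrow>\<^sub>0 nat) = (\<Sum>v\<in>UNIV. Poly_Mapping.lookup N v)"
  unfolding mdeg_def by (rule sum.mono_neutral_left) (auto simp: in_keys_iff)

lemma finite_mdeg_le: "finite {N :: 'v::finite \<Rightarrow>\<^sub>0 nat. mdeg N \<le> n}"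
proof -
  have "finite {f :: 'v \<Rightarrow> nat. \<forall>v. (v \<in> UNIV \<longrightarrow> f v \<in> {..n}) \<and> (v \<notin> UNIV \<longrightarrow> f v = 0)}"
    by (rule finite_set_of_finite_funs) auto
  then have "finite (Poly_Mapping.lookup -` {f :: 'v \<Rightarrow> nat. \<forall>v. f v \<le> n})"
    by (intro finite_vimageI) (simp_all add: inj_on_def)
  moreover have "Poly_Mapping.lookup N v \<le> n" if "mdeg N \<le> n" for N :: "'v \<Rightarrow>\<^sub>0 nat" and v
    using that member_le_sum[of v UNIV "Poly_Mapping.lookup N"] by (simp add: mdeg_UNIV)
  ultimately show ?thesis
    by (elim rev_finite_subset) auto
qed

lemma mcoeff_mpow_eq_0:
  assumes "\<And>v. mcoeff (z v) 0 = 0" "mdeg M < mdeg N"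
  shows "mcoeff (mpow z N) M = 0"
proof -
  have "vanishes_below (\<Sum>v\<in>UNIV. Poly_Mapping.lookup N v * Suc 0) (mpow z N)"
    unfolding mpow_def
    by (intro vanishes_below_prod vanishes_below_power) (simp add: vanishes_below_1_iff assms(1))
  then show ?thesis using assms(2) by (simp add: vanishes_below_def mdeg_UNIV)
qed

text \<open>A common cut-off for all factors of a product is needed to multiply substituted series.\<close>

lemma mcoeff_msubst_superset:
  assumes "\<And>v. mcoeff (z v) 0 = 0" "mdeg M \<le> n"
  shows "mcoeff (msubst z F) M = (\<Sum>N | mdeg N \<le> n. mcoeff (mpow z N) M *\<^sub>Q mcoeff F N)"
  unfolding mcoeff_msubst
  by (rule sum.mono_neutral_left) (use assms in \<open>auto simp: finite_mdeg_le mcoeff_mpow_eq_0\<close>)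

lemma filtered_msubst: "filtered (msubst z)"
  by (auto simp: filtered_def eq_upto_def mcoeff_msubst intro!: sum.cong)

lemma msubst_mmap: "rat_linear f \<Longrightarrow> msubst z (mmap f F) = mmap f (msubst z F)"
  by (rule mfps_eqI) (simp add: mcoeff_msubst rat_lin.linear_sum rat_lin.linear_scale)

lemma rat_linear_msubst: "rat_linear (msubst z)"
  by (rule rat_linearI; rule mfps_eqI)
    (simp_all add: mcoeff_msubst scaleQ_add_right sum.distrib rat_vec.scale_sum_right mult.commute)

lemma rat_alg_hom_msubst:
  fixes z :: "'v::finite \<Rightarrow> ('w, rat) mfps"
  assumes z: "\<And>v. mcoeff (z v) 0 = 0"
  shows "rat_alg_hom (msubst z :: ('v, 'a::rat_algebra) mfps \<Rightarrow> _)"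
proof -
  have "msubst z 1 = (1 :: ('w, 'a) mfps)"
  proof (rule mfps_eqI)
    fix M
    have "mcoeff (msubst z (1 :: ('v, 'a) mfps)) M =
        (\<Sum>N\<in>{0}. mcoeff (mpow z N) M *\<^sub>Q mcoeff (1 :: ('v, 'a) mfps) N)"
      unfolding mcoeff_msubst by (rule sum.mono_neutral_right) (auto simp: finite_mdeg_le mcoeff_1)
    then show "mcoeff (msubst z (1 :: ('v, 'a) mfps)) M = mcoeff 1 M"
      by (simp add: mcoeff_1 scaleQ_one)
  qed
  moreover have "msubst z (F * G) = msubst z F * msubst z G" for F G :: "('v, 'a) mfps"
  proof (rule mfps_eqI)
    fix M :: "'w \<Rightarrow>\<^sub>0 nat"
    define T where "T = {N :: 'v \<Rightarrow>\<^sub>0 nat. mdeg N \<le> mdeg M}"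
    have T: "finite T" by (simp add: T_def finite_mdeg_le)
    have high: "mcoeff (mpow z N) M = 0" if "N \<notin> T" for N
      using that mcoeff_mpow_eq_0[OF z, of M N] by (simp add: T_def)
    let ?h = "\<lambda>K L. mcoeff (mpow z (K + L)) M *\<^sub>Q (mcoeff F K * mcoeff G L)"
    have "mcoeff (msubst z (F * G)) M = (\<Sum>N\<in>T. \<Sum>(K, L)\<in>decomps N. ?h K L)"
      by (auto simp: mcoeff_msubst T_def mcoeff_mult rat_vec.scale_sum_right decomps_def intro!: sum.cong)
    also have "\<dots> = (\<Sum>(N, K, L)\<in>(SIGMA N:T. decomps N). ?h K L)"
      by (simp add: sum.Sigma T finite_decomps)
    also have "\<dots> = (\<Sum>(K, L)\<in>{p \<in> T \<times> T. fst p + snd p \<in> T}. ?h K L)"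
      by (rule sum.reindex_bij_witness[of _ "\<lambda>(K, L). (K + L, K, L)" snd])
        (auto simp: decomps_def T_def mdeg_add)
    also have "\<dots> = (\<Sum>(K, L)\<in>T \<times> T. ?h K L)"
      by (rule sum.mono_neutral_left) (auto simp: T, use high in blast)
    also have "\<dots> = (\<Sum>(K, L)\<in>T \<times> T. \<Sum>(M1, M2)\<in>decomps M.
        (mcoeff (mpow z K) M1 *\<^sub>Q mcoeff F K) * (mcoeff (mpow z L) M2 *\<^sub>Q mcoeff G L))"
      by (simp add: mpow_add mcoeff_mult rat_vec.scale_sum_left case_prod_beta mult_scaleQ_left
          mult_scaleQ_right scaleQ_scaleQ mult.commute)
    also have "\<dots> = (\<Sum>(M1, M2)\<in>decomps M. \<Sum>(K, L)\<in>T \<times> T.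
        (mcoeff (mpow z K) M1 *\<^sub>Q mcoeff F K) * (mcoeff (mpow z L) M2 *\<^sub>Q mcoeff G L))"
      unfolding case_prod_beta by (rule sum.swap)
    also have "\<dots> = (\<Sum>(M1, M2)\<in>decomps M. mcoeff (msubst z F) M1 * mcoeff (msubst z G) M2)"
    proof (rule sum.cong, simp, clarify)
      fix M1 M2 assume "(M1, M2) \<in> decomps M"
      then have le: "mdeg M1 \<le> mdeg M" "mdeg M2 \<le> mdeg M" by (simp_all add: mdeg_decomps)
      show "(\<Sum>(K, L)\<in>T \<times> T. (mcoeff (mpow z K) M1 *\<^sub>Q mcoeff F K) * (mcoeff (mpow z L) M2 *\<^sub>Q mcoeff G L)) =
          mcoeff (msubst z F) M1 * mcoeff (msubst z G) M2"
        unfolding mcoeff_msubst_superset[OF z le(1)] mcoeff_msubst_superset[OF z le(2)] sum_product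
        by (simp add: T_def sum.cartesian_product)
    qed
    finally show "mcoeff (msubst z (F * G)) M = mcoeff (msubst z F * msubst z G) M"
      by (simp add: mcoeff_mult)
  qed
  ultimately show ?thesis using rat_linear_msubst by (simp add: rat_alg_hom_def)
qed

lemma msubst_variable:
  assumes "mcoeff (z v) 0 = 0"
  shows "msubst z (mmonom (Poly_Mapping.single v 1) a) = mmap (\<lambda>q. q *\<^sub>Q a) (z v)"
proof (rule mfps_eqI)
  fix M
  let ?s = "Poly_Mapping.single v (1::nat)"
  have deg: "mdeg ?s = 1" by (simp add: mdeg_def)
  have "mcoeff (msubst z (mmonom ?s a)) M =
      (\<Sum>N | mdeg N \<le> mdeg M. if N = ?s then mcoeff (z v) M *\<^sub>Q a else 0)"
    unfolding mcoeff_msubst by (intro sum.cong) (auto simp: mcoeff_mmonom mpow_single)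
  also have "\<dots> = (if mdeg ?s \<le> mdeg M then mcoeff (z v) M *\<^sub>Q a else 0)"
    by (simp add: finite_mdeg_le)
  also have "\<dots> = mcoeff (z v) M *\<^sub>Q a"
  proof (cases "M = 0")
    case False
    then show ?thesis using mdeg_eq_0_iff[of M] deg by simp
  qed (simp add: assms)
  finally show "mcoeff (msubst z (mmonom ?s a)) M = mcoeff (mmap (\<lambda>q. q *\<^sub>Q a) (z v)) M"
    by simp
qed


section \<open>Exponentials of lifted logarithms\<close>

definition explog :: "('v, 'l::{rat_algebra, rat_lie_algebra}) mfps \<Rightarrow> ('v, 'l uea) mfps" where
  "explog F = mexp (mmap \<iota> (mlog F))"

lemma rat_linear_\<iota>: "rat_linear \<iota>"
  by (rule rat_linearI) (simp_all add: \<iota>_simps)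

lemma \<iota>_0 [simp]: "\<iota> 0 = 0"
  by (rule rat_lin.linear_0[OF rat_linear_\<iota>])

lemma explog_mult:
  fixes F G :: "('v, 'l::{comm_ring_1, rat_algebra, abelian_rat_lie_algebra}) mfps"
  assumes "mcoeff F 0 = 1" "mcoeff G 0 = 1"
  shows "explog (F * G) = explog F * explog G"
  using assms
  by (simp add: explog_def mlog_mult mexp_add mcoeff_mlog_0 rat_lin.linear_add[OF rat_linear_mmap[OF rat_linear_\<iota>]])

lemma explog_msubst:
  assumes z: "\<And>v. mcoeff (z v) 0 = 0" and F: "mcoeff F 0 = 1"
  shows "explog (msubst z F) = msubst z (explog F)"
proof -
  have "mlog (msubst z F) = msubst z (mlog F)"
    by (rule filtered_mlog[symmetric, OF rat_alg_hom_msubst[OF z] filtered_msubst F])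
  moreover have "mexp (msubst z (mmap \<iota> (mlog F))) = msubst z (mexp (mmap \<iota> (mlog F)))"
    by (rule filtered_mexp[symmetric, OF rat_alg_hom_msubst[OF z] filtered_msubst])
      (simp add: mcoeff_mlog_0[OF F])
  ultimately show ?thesis
    by (simp add: explog_def msubst_mmap[OF rat_linear_\<iota>, symmetric])
qed

lemma mmap_explog:
  assumes "rat_alg_hom f" "mcoeff F 0 = 1"
  shows "mmap f (explog F) = mexp (mmap (\<lambda>x. f (\<iota> x)) (mlog F))"
proof -
  have "mmap f (explog F) = mexp (mmap f (mmap \<iota> (mlog F)))"
    unfolding explog_def
    by (rule filtered_mexp[OF rat_alg_hom_mmap[OF assms(1)] filtered_mmap])
      (simp add: mcoeff_mlog_0[OF assms(2)])
  also have "mmap f (mmap \<iota> (mlog F)) = mmap (\<lambda>x. f (\<iota> x)) (mlog F)"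
    by (rule mfps_eqI) simp
  finally show ?thesis .
qed


section \<open>Integral coefficients\<close>

definition is_subring :: "'a::ring_1 set \<Rightarrow> bool" where
  "is_subring S \<longleftrightarrow> 1 \<in> S \<and> (\<forall>a\<in>S. \<forall>b\<in>S. a - b \<in> S \<and> a * b \<in> S)"

lemma is_subring_0: "is_subring S \<Longrightarrow> 0 \<in> S"
  unfolding is_subring_def by (metis diff_self)

lemma is_subring_add: "is_subring S \<Longrightarrow> a \<in> S \<Longrightarrow> b \<in> S \<Longrightarrow> a + b \<in> S"
  using is_subring_0[of S] unfolding is_subring_def by (metis diff_0 diff_minus_eq_add)

lemma is_subring_sum: "is_subring S \<Longrightarrow> (\<And>i. i \<in> A \<Longrightarrow> f i \<in> S) \<Longrightarrow> sum f A \<in> S"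
  by (induction A rule: infinite_finite_induct) (simp_all add: is_subring_0 is_subring_add)

lemma is_subring_power: "is_subring S \<Longrightarrow> a \<in> S \<Longrightarrow> a ^ k \<in> S"
  by (induction k) (auto simp: is_subring_def)

lemma is_subring_prod: "is_subring S \<Longrightarrow> (\<And>i. i \<in> A \<Longrightarrow> f i \<in> S) \<Longrightarrow> prod f A \<in> S"
  by (induction A rule: infinite_finite_induct) (auto simp: is_subring_def)

lemma is_subring_Ints: "is_subring \<int>"
  by (auto simp: is_subring_def)

definition coeffs_in :: "'a set \<Rightarrow> ('v, 'a) mfps set" where
  "coeffs_in S = {F. \<forall>N. mcoeff F N \<in> S}"

lemma is_subring_coeffs_in:
  assumes "is_subring S"
  shows "is_subring (coeffs_in S :: ('v, 'a::ring_1) mfps set)"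
proof -
  have mult: "a * b \<in> S" if "a \<in> S" "b \<in> S" for a b
    using assms that by (simp add: is_subring_def)
  have "mcoeff (F * G) N \<in> S" if "F \<in> coeffs_in S" "G \<in> coeffs_in S" for F G :: "('v, 'a) mfps" and N
    unfolding mcoeff_mult using that
    by (intro is_subring_sum[OF assms]) (auto simp: coeffs_in_def intro: mult)
  moreover have "(1 :: ('v, 'a) mfps) \<in> coeffs_in S"
    using assms is_subring_0[OF assms] by (simp add: coeffs_in_def mcoeff_1 is_subring_def)
  ultimately show ?thesis
    using assms by (auto simp: is_subring_def coeffs_in_def)
qed

lemma mpow_coeffs_in:
  assumes "is_subring S" "\<And>v. z v \<in> coeffs_in S"
  shows "mpow z N \<in> coeffs_in S"
  unfolding mpow_def using is_subring_coeffs_in[OF assms(1)] assms(2)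
  by (intro is_subring_prod is_subring_power)

lemma minv_coeffs_in:
  assumes "is_subring S" "F \<in> coeffs_in S"
  shows "minv F \<in> coeffs_in S"
proof -
  have S: "is_subring (coeffs_in S :: ('b, 'a) mfps set)"
    by (rule is_subring_coeffs_in[OF assms(1)])
  then have "1 - F \<in> coeffs_in S" using assms(2) by (simp add: is_subring_def)
  then have "(\<Sum>k\<le>n. (1 - F) ^ k) \<in> coeffs_in S" for n
    by (intro is_subring_sum is_subring_power S)
  then show ?thesis by (simp add: coeffs_in_def minv_def Abs_mfps_inverse)
qed

text \<open>These are the integral combinations of class sums, by \<open>center_eq_sum_class_sums\<close>. In this
  description closure under products is plain, without structure constants.\<close>

definition integral_center :: "'g::monoid_add center set" where
  "integral_center = {x. \<forall>g. Poly_Mapping.lookup (Rep_center x) g \<in> \<int>}"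

lemma is_subring_integral_center: "is_subring (integral_center :: 'g::monoid_add center set)"
proof -
  have "Poly_Mapping.lookup (p * q) g \<in> \<int>"
    if "\<And>g. Poly_Mapping.lookup p g \<in> \<int>" "\<And>g. Poly_Mapping.lookup q g \<in> \<int>" for p q :: "'g \<Rightarrow>\<^sub>0 rat" and g
    unfolding lookup_mult Sum_any.expand_set
    by (intro Ints_sum Ints_mult that) (auto simp: when_def that)
  then show ?thesis
    by (auto simp: is_subring_def integral_center_def times_center.rep_eq minus_center.rep_eq
        one_center.rep_eq lookup_minus lookup_one when_def)
qed

lemma lookup_class_sum:
  "Poly_Mapping.lookup (Rep_center (class_sum c)) g = (if abs_conj_class g = c then 1 else 0)"
proof -
  have "Poly_Mapping.lookup (Rep_center (class_sum c)) g = (\<Sum>x | abs_conj_class x = c. if x = g then 1 else 0)"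
    by (simp add: Rep_class_sum lookup_sum lookup_single when_def)
  then show ?thesis by simp
qed

lemma lookup_mult_single:
  fixes p :: "'g::group_add \<Rightarrow>\<^sub>0 rat"
  shows "Poly_Mapping.lookup (p * Poly_Mapping.single h 1) (g + h) = Poly_Mapping.lookup p g"
    "Poly_Mapping.lookup (Poly_Mapping.single h 1 * p) (h + g) = Poly_Mapping.lookup p g"
  by (induction p rule: poly_mapping_add_induct)
    (simp_all add: mult_single lookup_single when_def distrib_left distrib_right lookup_add)

text \<open>If \<open>h\<close> conjugates \<open>g\<close> to \<open>k\<close>, compare the coefficients of \<open>x h = h x\<close> at \<open>k + h = h + g\<close>.\<close>

lemma lookup_center_conj:
  fixes x :: "'g::group_add center"
  assumes "conjugate g k"
  shows "Poly_Mapping.lookup (Rep_center x) k = Poly_Mapping.lookup (Rep_center x) g"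
proof -
  obtain h where "k = h + g - h" using assms by (auto simp: conjugate_def)
  then have "k + h = h + g" by simp
  have "Poly_Mapping.lookup (Rep_center x) k =
      Poly_Mapping.lookup (Rep_center x * Poly_Mapping.single h 1) (k + h)"
    by (simp only: lookup_mult_single)
  also have "\<dots> = Poly_Mapping.lookup (Poly_Mapping.single h 1 * Rep_center x) (h + g)"
    using Rep_center[of x] by (simp add: \<open>k + h = h + g\<close>)
  also have "\<dots> = Poly_Mapping.lookup (Rep_center x) g"
    by (rule lookup_mult_single)
  finally show ?thesis .
qed

lemma lookup_Rep_center_sum:
  "Poly_Mapping.lookup (Rep_center (\<Sum>i\<in>A. f i)) g = (\<Sum>i\<in>A. Poly_Mapping.lookup (Rep_center (f i)) g)"
  by (induction A rule: infinite_finite_induct) (simp_all add: zero_center.rep_eq plus_center.rep_eq lookup_add)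

lemma center_eq_sum_class_sums:
  fixes x :: "'g::{group_add, finite} center"
  shows "x = (\<Sum>c\<in>UNIV. Poly_Mapping.lookup (Rep_center x) (rep_conj_class c) *\<^sub>Q class_sum c)"
proof -
  have "Poly_Mapping.lookup (Rep_center x) g =
      Poly_Mapping.lookup (Rep_center x) (rep_conj_class (abs_conj_class g))" for g
    by (rule lookup_center_conj)
      (metis Quotient3_conj_class equivp_conjugate equivp_reflp rep_abs_rsp_left)
  then have "Rep_center x = Rep_center (\<Sum>c\<in>UNIV. Poly_Mapping.lookup (Rep_center x) (rep_conj_class c) *\<^sub>Q class_sum c)"
    by (intro poly_mapping_eqI)
      (simp add: lookup_Rep_center_sum scaleQ_center.rep_eq lookup_scaleQ lookup_class_sum scaleQ_rat_def if_distrib cong: if_cong)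
  then show ?thesis by (simp only: Rep_center_inject)
qed


section \<open>The generating series\<close>

definition gen_series :: "('g::{group_add, finite} conj_class, 'g center) mfps" where
  "gen_series = 1 + (\<Sum>c\<in>UNIV. mmonom (Poly_Mapping.single c 1) (class_sum c))"

lemma B_coeff_eq: "B_coeff N = mcoeff (explog gen_series) N"
  by (simp add: B_coeff_def explog_def gen_series_def)

lemma single_1_neq_0: "Poly_Mapping.single c (Suc 0) \<noteq> 0"
  by (metis lookup_single_eq lookup_zero nat.distinct(1))

lemma mcoeff_gen_series_0: "mcoeff gen_series 0 = 1"
  by (auto simp: gen_series_def mcoeff_sum mcoeff_mmonom mcoeff_1 single_1_neq_0 intro!: sum.neutral)

lemma gen_series_coeffs_in: "gen_series \<in> coeffs_in (integral_center :: 'g::{group_add, finite} center set)"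
proof -
  have "class_sum c \<in> (integral_center :: 'g center set)" for c
    by (simp add: integral_center_def lookup_class_sum)
  moreover have "(0 :: 'g center) \<in> integral_center"
    by (rule is_subring_0[OF is_subring_integral_center])
  ultimately have "mmonom M (class_sum c) \<in> coeffs_in (integral_center :: 'g center set)" for M :: "'g conj_class \<Rightarrow>\<^sub>0 nat" and c
    by (simp add: coeffs_in_def mcoeff_mmonom)
  moreover have S: "is_subring (coeffs_in integral_center :: ('g conj_class, 'g center) mfps set)"
    by (intro is_subring_coeffs_in is_subring_integral_center)
  ultimately show ?thesis
    unfolding gen_series_def using S
    by (intro is_subring_add[OF S] is_subring_sum[OF S]) (auto simp: is_subring_def)
qed

lemma msubst_gen_series:
  fixes z :: "'g::{group_add, finite} conj_class \<Rightarrow> ('w, rat) mfps"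
  assumes z: "\<And>c. mcoeff (z c) 0 = 0"
  shows "msubst z gen_series = 1 + (\<Sum>c\<in>UNIV. mmap (\<lambda>q. q *\<^sub>Q class_sum c) (z c))"
proof -
  have "rat_alg_hom (msubst z :: ('g conj_class, 'g center) mfps \<Rightarrow> _)"
    by (rule rat_alg_hom_msubst) (rule z)
  then have "msubst z (1 :: ('g conj_class, 'g center) mfps) = 1"
    by (simp add: rat_alg_hom_def)
  then show ?thesis
    by (simp add: gen_series_def rat_lin.linear_add[OF rat_linear_msubst]
        rat_lin.linear_sum[OF rat_linear_msubst] msubst_variable[of z, OF z, unfolded One_nat_def])
qed

lemma of_int_scaleQ: "of_int n *\<^sub>Q (x :: 'a::rat_algebra) = of_int n * x"
proof -
  have nat: "of_nat m *\<^sub>Q (1 :: 'a) = of_nat m" for m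
    by (induction m) (simp_all add: scaleQ_add_left scaleQ_one)
  have "of_int n *\<^sub>Q (1 :: 'a) = of_int n"
    by (cases n) (simp_all add: nat del: of_nat_Suc)
  then show ?thesis by (metis mult_1 mult_scaleQ_left)
qed

lemma R_scaleQ_Ints: "q \<in> \<int> \<Longrightarrow> x \<in> R\<^sub>\<Gamma> \<Longrightarrow> q *\<^sub>Q x \<in> R\<^sub>\<Gamma>"
  unfolding R\<^sub>\<Gamma>_def by (elim Ints_cases) (simp add: of_int_scaleQ int_mod.span_scale)

text \<open>The coefficients are \<open>\<Sum>\<^sub>N (z\<^sup>N)\<^sub>M B\<^sub>N\<close> with integers \<open>(z\<^sup>N)\<^sub>M\<close>.\<close>

lemma msubst_explog_gen_series_coeffs_in:
  assumes "\<And>c. z c \<in> coeffs_in \<int>"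
  shows "msubst z (explog gen_series) \<in> coeffs_in R\<^sub>\<Gamma>"
proof -
  have "mcoeff (mpow z N) M \<in> \<int>" for N M
    using mpow_coeffs_in[of \<int> z, OF is_subring_Ints assms] by (simp add: coeffs_in_def)
  moreover have "mcoeff (explog gen_series) N \<in> R\<^sub>\<Gamma>" for N
    unfolding B_coeff_eq[symmetric] R\<^sub>\<Gamma>_def by (rule int_mod.span_base) simp
  ultimately show ?thesis
    by (auto simp: coeffs_in_def mcoeff_msubst R\<^sub>\<Gamma>_def intro!: int_mod.span_sum R_scaleQ_Ints[unfolded R\<^sub>\<Gamma>_def])
qed

text \<open>\<open>F\<close> is the generating series with \<open>x\<^sub>c\<close> replaced by the series \<open>z\<^sub>c\<close> of the coordinates of the
  coefficients of \<open>F\<close> with respect to the class sum \<open>c\<close>. The value at \<open>N = 0\<close> is set to 0 because the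
  constant term 1 of \<open>F\<close> is already present in the generating series.\<close>

lemma explog_coeffs_in:
  fixes F :: "('w, 'g::{group_add, finite} center) mfps"
  assumes F0: "mcoeff F 0 = 1" and F: "F \<in> coeffs_in integral_center"
  shows "explog F \<in> coeffs_in R\<^sub>\<Gamma>"
proof -
  define z :: "'g conj_class \<Rightarrow> ('w, rat) mfps" where
    "z c = Abs_mfps (\<lambda>N. if N = 0 then 0 else Poly_Mapping.lookup (Rep_center (mcoeff F N)) (rep_conj_class c))" for c
  have mz: "mcoeff (z c) N = (if N = 0 then 0 else Poly_Mapping.lookup (Rep_center (mcoeff F N)) (rep_conj_class c))" for c N
    by (simp add: z_def Abs_mfps_inverse)
  have z0: "mcoeff (z c) 0 = 0" for c by (simp add: mz)
  have zZ: "z c \<in> coeffs_in \<int>" for c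
    using F by (simp add: coeffs_in_def mz integral_center_def)
  have "msubst z gen_series = F"
  proof (rule mfps_eqI)
    fix N
    show "mcoeff (msubst z gen_series) N = mcoeff F N"
    proof (cases "N = 0")
      case False
      then show ?thesis
        by (simp add: msubst_gen_series[of z, OF z0] mcoeff_1 mcoeff_sum mz center_eq_sum_class_sums[of "mcoeff F N", symmetric])
    qed (simp add: msubst_gen_series[of z, OF z0] mcoeff_1 mcoeff_sum z0 F0)
  qed
  then have "explog F = msubst z (explog gen_series)"
    using explog_msubst[of z, OF z0 mcoeff_gen_series_0] by simp
  then show ?thesis using msubst_explog_gen_series_coeffs_in[of z, OF zZ] by simp
qed

lemma msubst_gen_series_coeffs_in:
  fixes z :: "'g::{group_add, finite} conj_class \<Rightarrow> ('w, rat) mfps"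
  assumes z0: "\<And>c. mcoeff (z c) 0 = 0" and z: "\<And>c. z c \<in> coeffs_in \<int>"
  shows "mcoeff (msubst z gen_series) 0 = 1" "msubst z gen_series \<in> coeffs_in integral_center"
proof -
  show "mcoeff (msubst z gen_series) 0 = 1"
    by (simp add: msubst_gen_series[of z, OF z0] mcoeff_1 mcoeff_sum z0)
  have "mmap (\<lambda>q. q *\<^sub>Q class_sum c) (z c) \<in> coeffs_in integral_center" for c
    using z by (simp add: coeffs_in_def integral_center_def scaleQ_center.rep_eq lookup_scaleQ lookup_class_sum scaleQ_rat_def)
  moreover have S: "is_subring (coeffs_in (integral_center :: 'g center set) :: ('w, 'g center) mfps set)"
    by (intro is_subring_coeffs_in is_subring_integral_center)
  moreover have "1 \<in> (coeffs_in (integral_center :: 'g center set) :: ('w, 'g center) mfps set)"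
    using S by (simp add: is_subring_def)
  ultimately show "msubst z gen_series \<in> coeffs_in integral_center"
    unfolding msubst_gen_series[of z, OF z0] by (intro is_subring_add[OF S] is_subring_sum[OF S])
qed


section \<open>Products\<close>

text \<open>The exponent of the monomial that arises from \<open>x\<^sup>N\<close> by renaming \<open>x\<^sub>v\<close> to \<open>x\<^bsub>i v\<^esub>\<close>.\<close>

definition rename_mono :: "('v::finite \<Rightarrow> 'w) \<Rightarrow> ('v \<Rightarrow>\<^sub>0 nat) \<Rightarrow> ('w \<Rightarrow>\<^sub>0 nat)" where
  "rename_mono i N = (\<Sum>v\<in>UNIV. Poly_Mapping.single (i v) (Poly_Mapping.lookup N v))"

lemma lookup_rename_mono:
  "inj i \<Longrightarrow> Poly_Mapping.lookup (rename_mono i N) (i v) = Poly_Mapping.lookup N v"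
  by (simp add: rename_mono_def lookup_sum lookup_single when_def inj_eq)

lemma lookup_rename_mono_notin:
  "w \<notin> range i \<Longrightarrow> Poly_Mapping.lookup (rename_mono i N) w = 0"
  by (auto simp: rename_mono_def lookup_sum lookup_single when_def intro!: sum.neutral)

lemma inj_rename_mono: "inj i \<Longrightarrow> inj (rename_mono i)"
  by (metis injI lookup_rename_mono poly_mapping_eqI)

lemma mmonom_mult: "mmonom M a * mmonom N b = mmonom (M + N) (a * b)"
proof (rule mfps_eqI)
  fix L
  have "mcoeff (mmonom M a * mmonom N b) L = (\<Sum>p\<in>decomps L. if p = (M, N) then a * b else 0)"
    by (auto simp: mcoeff_mult mcoeff_mmonom intro!: sum.cong)
  also have "\<dots> = (if (M, N) \<in> decomps L then a * b else 0)"
    by (simp add: finite_decomps)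
  finally show "mcoeff (mmonom M a * mmonom N b) L = mcoeff (mmonom (M + N) (a * b)) L"
    by (auto simp: mcoeff_mmonom decomps_def)
qed

lemma mmonom_0_1: "mmonom 0 1 = 1"
  by (rule mfps_eqI) (simp add: mcoeff_mmonom mcoeff_1)

lemma mpow_rename:
  "mpow (\<lambda>v. mmonom (Poly_Mapping.single (i v) 1) 1) N = mmonom (rename_mono i N) 1"
proof -
  have "mmonom (Poly_Mapping.single w 1) 1 ^ k = (mmonom (Poly_Mapping.single w k) 1 :: ('a, 'b) mfps)" for w k
    by (induction k) (simp_all add: mmonom_0_1 mmonom_mult flip: single_add)
  moreover have "(\<Prod>v\<in>A. mmonom (f v) 1) = (mmonom (\<Sum>v\<in>A. f v) 1 :: ('a, 'b) mfps)" for A :: "'c set" and f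
    by (induction A rule: infinite_finite_induct) (simp_all add: mmonom_0_1 mmonom_mult)
  ultimately show ?thesis by (simp add: mpow_def rename_mono_def)
qed

lemma
  fixes F :: "('v::finite, 'a::rat_vector) mfps" and i :: "'v \<Rightarrow> 'w"
  defines "z \<equiv> \<lambda>v. mmonom (Poly_Mapping.single (i v) 1) 1"
  shows rename_variable_0: "mcoeff (z v) 0 = 0"
    and rename_variable_Ints: "z v \<in> coeffs_in \<int>"
    and mcoeff_rename: "inj i \<Longrightarrow> mcoeff (msubst z F) (rename_mono i N) = mcoeff F N"
    and mcoeff_rename_notin: "M \<notin> range (rename_mono i) \<Longrightarrow> mcoeff (msubst z F) M = 0"
proof -
  show z0: "mcoeff (z v) 0 = 0" for v
    by (simp add: z_def mcoeff_mmonom single_1_neq_0)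
  show "z v \<in> coeffs_in \<int>"
    by (simp add: z_def coeffs_in_def mcoeff_mmonom)
  have pow: "mcoeff (mpow z K) M = (if M = rename_mono i K then 1 else 0)" for K M
    unfolding z_def mpow_rename by (rule mcoeff_mmonom)
  show "mcoeff (msubst z F) M = 0" if "M \<notin> range (rename_mono i)" for M
    using that by (auto simp: mcoeff_msubst pow intro!: sum.neutral)
  assume i: "inj i"
  have "mcoeff (mpow z N) (rename_mono i N) \<noteq> 0" by (simp add: pow)
  then have "mdeg N \<le> mdeg (rename_mono i N)"
    by (rule contrapos_np) (rule mcoeff_mpow_eq_0, rule z0, simp)
  have "mcoeff (msubst z F) (rename_mono i N) =
      (\<Sum>K | mdeg K \<le> mdeg (rename_mono i N). if K = N then mcoeff F N else 0)"
    unfolding mcoeff_msubst pow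
    by (intro sum.cong) (auto simp: inj_eq[OF inj_rename_mono[OF i]] scaleQ_one)
  then show "mcoeff (msubst z F) (rename_mono i N) = mcoeff F N"
    using \<open>mdeg N \<le> _\<close> by (simp add: finite_mdeg_le)
qed

text \<open>The two copies of the set of conjugacy classes in the sum type serve as disjoint sets of
  variables \<open>x\<close> and \<open>y\<close>: the monomial \<open>x\<^sup>M y\<^sup>N\<close> determines \<open>M\<close> and \<open>N\<close>, so only the product \<open>B\<^sub>M B\<^sub>N\<close>
  contributes to its coefficient.\<close>

lemma B_coeff_mult: "B_coeff M * B_coeff N \<in> (R\<^sub>\<Gamma> :: 'g::{group_add, finite} center uea set)"
proof -
  define zl :: "'g conj_class \<Rightarrow> ('g conj_class + 'g conj_class, rat) mfps" where
    "zl = (\<lambda>c. mmonom (Poly_Mapping.single (Inl c) 1) 1)"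
  define zr :: "'g conj_class \<Rightarrow> ('g conj_class + 'g conj_class, rat) mfps" where
    "zr = (\<lambda>c. mmonom (Poly_Mapping.single (Inr c) 1) 1)"
  have zl: "mcoeff (zl c) 0 = 0" "zl c \<in> coeffs_in \<int>" for c
    unfolding zl_def by (rule rename_variable_0, rule rename_variable_Ints)
  have zr: "mcoeff (zr c) 0 = 0" "zr c \<in> coeffs_in \<int>" for c
    unfolding zr_def by (rule rename_variable_0, rule rename_variable_Ints)
  let ?E = "explog (gen_series :: ('g conj_class, 'g center) mfps)"
  let ?F = "msubst zl gen_series * msubst zr gen_series"
  have "is_subring (coeffs_in integral_center :: ('g conj_class + 'g conj_class, 'g center) mfps set)"
    by (rule is_subring_coeffs_in[OF is_subring_integral_center])
  then have "?F \<in> coeffs_in integral_center"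
    using msubst_gen_series_coeffs_in(2)[of zl, OF zl] msubst_gen_series_coeffs_in(2)[of zr, OF zr]
    by (simp add: is_subring_def)
  moreover have "mcoeff ?F 0 = 1"
    by (simp add: mcoeff_mult_0 msubst_gen_series_coeffs_in(1)[of zl, OF zl] msubst_gen_series_coeffs_in(1)[of zr, OF zr])
  ultimately have "explog ?F \<in> coeffs_in R\<^sub>\<Gamma>" by (intro explog_coeffs_in)
  moreover have "explog ?F = msubst zl ?E * msubst zr ?E"
    using explog_mult[OF msubst_gen_series_coeffs_in(1)[of zl, OF zl] msubst_gen_series_coeffs_in(1)[of zr, OF zr]]
    by (simp add: explog_msubst[of zl, OF zl(1) mcoeff_gen_series_0] explog_msubst[of zr, OF zr(1) mcoeff_gen_series_0])
  moreover have "mcoeff (msubst zl ?E * msubst zr ?E) (rename_mono Inl M + rename_mono Inr N) = B_coeff M * B_coeff N"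
  proof -
    let ?MN = "rename_mono Inl M + rename_mono Inr N"
    have uniq: "M' = M \<and> N' = N" if "rename_mono Inl M' + rename_mono Inr N' = ?MN" for M' N' :: "'g conj_class \<Rightarrow>\<^sub>0 nat"
    proof -
      have "Poly_Mapping.lookup M' c = Poly_Mapping.lookup M c" "Poly_Mapping.lookup N' c = Poly_Mapping.lookup N c" for c
        using arg_cong[OF that, of "\<lambda>p. Poly_Mapping.lookup p (Inl c)"] arg_cong[OF that, of "\<lambda>p. Poly_Mapping.lookup p (Inr c)"]
        by (auto simp: lookup_add lookup_rename_mono lookup_rename_mono_notin image_iff)
      then show ?thesis by (auto intro: poly_mapping_eqI)
    qed
    have notl: "mcoeff (msubst zl ?E) K = 0" if "K \<notin> range (rename_mono Inl)" for K
      unfolding zl_def using that by (rule mcoeff_rename_notin)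
    have notr: "mcoeff (msubst zr ?E) L = 0" if "L \<notin> range (rename_mono Inr)" for L
      unfolding zr_def using that by (rule mcoeff_rename_notin)
    have "mcoeff (msubst zl ?E) K * mcoeff (msubst zr ?E) L = 0"
      if "(K, L) \<in> decomps ?MN - {(rename_mono Inl M, rename_mono Inr N)}" for K L
    proof (rule ccontr)
      assume "mcoeff (msubst zl ?E) K * mcoeff (msubst zr ?E) L \<noteq> 0"
      then have "K \<in> range (rename_mono Inl)" "L \<in> range (rename_mono Inr)"
        by (metis notl mult_zero_left, metis notr mult_zero_right)
      then show False using that uniq by (auto simp: decomps_def)
    qed
    then have "mcoeff (msubst zl ?E * msubst zr ?E) ?MN =
        (\<Sum>(K, L)\<in>{(rename_mono Inl M, rename_mono Inr N)}. mcoeff (msubst zl ?E) K * mcoeff (msubst zr ?E) L)"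
      unfolding mcoeff_mult
      by (intro sum.mono_neutral_right) (auto simp: finite_decomps, auto simp: decomps_def)
    moreover have "mcoeff (msubst zl ?E) (rename_mono Inl M) = B_coeff M"
      unfolding zl_def B_coeff_eq by (rule mcoeff_rename) simp
    moreover have "mcoeff (msubst zr ?E) (rename_mono Inr N) = B_coeff N"
      unfolding zr_def B_coeff_eq by (rule mcoeff_rename) simp
    ultimately show ?thesis by simp
  qed
  ultimately show ?thesis by (auto simp: coeffs_in_def dest: spec[of _ "rename_mono Inl M + rename_mono Inr N"])
qed

lemma span_mult_closed:
  assumes "\<And>a b. a \<in> S \<Longrightarrow> b \<in> S \<Longrightarrow> a * b \<in> int_mod.span S" "x \<in> int_mod.span S" "y \<in> int_mod.span S"
  shows "x * y \<in> int_mod.span (S :: 'a::comm_ring_1 set)"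
proof -
  have left: "a * y \<in> int_mod.span S" if a: "a \<in> S" for a
    using assms(3)
  proof (induction y rule: int_mod.span_induct_alt)
    case (step n b y)
    have "a * (of_int n * b + y) = of_int n * (a * b) + a * y" by (simp add: algebra_simps)
    then show ?case
      using step assms(1)[OF a] by (simp only: int_mod.span_add int_mod.span_scale)
  qed (simp add: int_mod.span_zero)
  show ?thesis
    using assms(2)
  proof (induction x rule: int_mod.span_induct_alt)
    case (step n a x)
    have "(of_int n * a + x) * y = of_int n * (a * y) + x * y" by (simp add: algebra_simps)
    then show ?case
      using step left by (simp only: int_mod.span_add int_mod.span_scale)
  qed (simp add: int_mod.span_zero)
qed


section \<open>Hopf operations\<close>

lemma rat_alg_hom_linear: "rat_alg_hom f \<Longrightarrow> rat_linear f"
  by (simp add: rat_alg_hom_def)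

lemma rat_alg_hom_comult: "rat_alg_hom comult"
  unfolding comult_def by (rule rat_alg_hom_uea_lift[OF lie_hom_comult])

lemma rat_alg_hom_counit: "rat_alg_hom counit"
  unfolding counit_def by (rule rat_alg_hom_uea_lift[OF lie_hom_counit])

text \<open>In general the antipode reverses products; here \<open>\<U>(\<gg>)\<close> is commutative.\<close>

lemma rat_alg_hom_antipode: "rat_alg_hom (antipode :: 'l::abelian_rat_lie_algebra uea \<Rightarrow> _)"
  by (rule rat_alg_homI)
    (simp_all add: antipode_def uea_lift[OF lie_hom_antipode] plus_opp.rep_eq scaleQ_opp.rep_eq
      one_opp.rep_eq times_opp.rep_eq mult.commute)

text \<open>The exponential of primitive elements is group-like: coefficientwise \<open>\<Delta>\<close> turns the exponent
  into the sum of its images under \<open>u \<mapsto> u \<otimes> 1\<close> and \<open>u \<mapsto> 1 \<otimes> u\<close>, and the exponential turns the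
  sum into a product.\<close>

lemma mcoeff_comult_explog:
  fixes F :: "('v, 'l::{rat_algebra, abelian_rat_lie_algebra}) mfps"
  assumes "mcoeff F 0 = 1"
  shows "comult (mcoeff (explog F) N) = (\<Sum>(K, L)\<in>decomps N. mcoeff (explog F) K \<otimes>\<^sub>Q mcoeff (explog F) L)"
proof -
  let ?l = "\<lambda>u :: 'l uea. u \<otimes>\<^sub>Q (1 :: 'l uea)" and ?r = "\<lambda>u :: 'l uea. (1 :: 'l uea) \<otimes>\<^sub>Q u"
  have l: "rat_alg_hom ?l" and r: "rat_alg_hom ?r"
    by (rule rat_alg_homI; simp add: tensor_simps)+
  have zero: "?l 0 = 0" "?r 0 = 0"
    using l r by (simp_all only: rat_alg_hom_def rat_lin.linear_0[of ?l] rat_lin.linear_0[of ?r])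
  have "mmap comult (explog F) = mexp (mmap (\<lambda>x. ?l (\<iota> x)) (mlog F) + mmap (\<lambda>x. ?r (\<iota> x)) (mlog F))"
    unfolding mmap_explog[OF rat_alg_hom_comult assms]
    by (intro arg_cong[of _ _ mexp] mfps_eqI) (simp add: comult_def uea_lift(1)[OF lie_hom_comult])
  also have "\<dots> = mexp (mmap (\<lambda>x. ?l (\<iota> x)) (mlog F)) * mexp (mmap (\<lambda>x. ?r (\<iota> x)) (mlog F))"
    by (intro mexp_add) (simp_all add: mcoeff_mlog_0[OF assms] zero)
  also have "\<dots> = mmap ?l (explog F) * mmap ?r (explog F)"
    by (simp only: mmap_explog[OF l assms] mmap_explog[OF r assms])
  finally have "mcoeff (mmap comult (explog F)) N = mcoeff (mmap ?l (explog F) * mmap ?r (explog F)) N"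
    by simp
  then show ?thesis by (simp add: mcoeff_mult tensor_simps)
qed

text \<open>The counit kills the exponent.\<close>

lemma mcoeff_counit_explog:
  fixes F :: "('v, 'l::{rat_algebra, rat_lie_algebra}) mfps"
  assumes "mcoeff F 0 = 1"
  shows "counit (mcoeff (explog F) N) = (if N = 0 then 1 else 0)"
proof -
  have "mmap counit (explog F) = mexp (0 :: ('v, rat) mfps)"
    unfolding mmap_explog[OF rat_alg_hom_counit assms]
    by (intro arg_cong[of _ _ mexp] mfps_eqI) (simp add: counit_def uea_lift(1)[OF lie_hom_counit])
  also have "mexp (0 :: ('v, rat) mfps) = 1"
  proof (rule eq_upto_ext)
    fix n
    have "(\<Sum>k\<le>n. (1 / fact k) *\<^sub>Q (0 :: ('v, rat) mfps) ^ k) = 1"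
      by (simp add: sum.atMost_shift scaleQ_one)
    then show "eq_upto n (mexp (0 :: ('v, rat) mfps)) 1"
      using eq_upto_mexp[of "0 :: ('v, rat) mfps" n] by simp
  qed
  finally show ?thesis
    by (metis mcoeff_1 mcoeff_simps(6))
qed

text \<open>The antipode negates the exponent, and \<open>- log F = log (F\<^sup>-\<^sup>1)\<close>.\<close>

lemma mmap_antipode_explog:
  fixes F :: "('v, 'l::{comm_ring_1, rat_algebra, abelian_rat_lie_algebra}) mfps"
  assumes F: "mcoeff F 0 = 1"
  shows "mmap antipode (explog F) = explog (minv F)"
proof -
  have "mlog 1 = mlog 1 + mlog (1 :: ('v, 'l) mfps)"
    using mlog_mult[of "1 :: ('v, 'l) mfps" 1] by (simp add: mcoeff_1)
  then have "mlog F + mlog (minv F) = 0"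
    by (simp add: minv_right[OF F] flip: mlog_mult[OF F mcoeff_minv_0[OF F]])
  then have log: "mlog (minv F) = - mlog F" by (simp add: eq_neg_iff_add_eq_0 add.commute)
  show ?thesis
    unfolding mmap_explog[OF rat_alg_hom_antipode F] unfolding explog_def log
    by (intro arg_cong[of _ _ mexp] mfps_eqI)
      (simp add: antipode_def uea_lift(1)[OF lie_hom_antipode] to_opp_inverse rat_lin.linear_neg[OF rat_linear_\<iota>])
qed

lemma rat_linear_span_image:
  fixes f :: "'a::rat_algebra \<Rightarrow> 'b::rat_algebra"
  assumes f: "rat_linear f" and S: "\<And>a. a \<in> S \<Longrightarrow> f a \<in> int_mod.span T" and x: "x \<in> int_mod.span S"
  shows "f x \<in> int_mod.span T"
  using x
proof (induction x rule: int_mod.span_induct_alt)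
  case base
  then show ?case by (simp add: rat_lin.linear_0[OF f] int_mod.span_zero)
next
  case (step n a y)
  have "f (of_int n * a) = of_int n * f a"
    using rat_lin.linear_scale[OF f, of "of_int n" a] by (simp only: of_int_scaleQ)
  then show ?case
    using step S by (simp add: rat_lin.linear_add[OF f] int_mod.span_add int_mod.span_scale)
qed

theorem propositionA6:
  shows "hopf_subalgebra_over_int (R\<^sub>\<Gamma> :: 'g::{group_add, finite} center uea set)"
proof -
  let ?R = "R\<^sub>\<Gamma> :: 'g center uea set"
  let ?T = "{a \<otimes>\<^sub>Q b | a b. a \<in> ?R \<and> b \<in> ?R}"
  note gen = mcoeff_gen_series_0[where ?'a = 'g]
  have B: "B_coeff N \<in> ?R" for N
    unfolding R\<^sub>\<Gamma>_def by (rule int_mod.span_base) simp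
  have "B_coeff 0 = (1 :: 'g center uea)"
    by (simp add: B_coeff_eq explog_def mcoeff_mexp_0 mcoeff_mlog_0[OF gen])
  then have one: "1 \<in> ?R" using B[of 0] by simp
  have mult: "a * b \<in> ?R" if "a \<in> ?R" "b \<in> ?R" for a b
    unfolding R\<^sub>\<Gamma>_def
  proof (rule span_mult_closed)
    show "a \<in> int_mod.span (range B_coeff)" "b \<in> int_mod.span (range B_coeff)"
      using that by (simp_all add: R\<^sub>\<Gamma>_def)
    show "x * y \<in> int_mod.span (range B_coeff)" if "x \<in> range B_coeff" "y \<in> range B_coeff"
      for x y :: "'g center uea"
      using that by (auto simp: B_coeff_mult[unfolded R\<^sub>\<Gamma>_def])
  qed
  have pure: "B_coeff K \<otimes>\<^sub>Q B_coeff L \<in> ?T" for K L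
    using B by blast
  have comult: "comult a \<in> int_mod.span ?T" if "a \<in> ?R" for a
  proof (rule rat_linear_span_image[where f = comult and S = "range B_coeff"])
    show "a \<in> int_mod.span (range B_coeff)" using that by (simp add: R\<^sub>\<Gamma>_def)
    show "rat_linear (comult :: 'g center uea \<Rightarrow> _)" by (rule rat_alg_hom_linear[OF rat_alg_hom_comult])
    fix b :: "'g center uea" assume "b \<in> range B_coeff"
    then obtain N where "b = B_coeff N" by auto
    then have "comult b = (\<Sum>(K, L)\<in>decomps N. B_coeff K \<otimes>\<^sub>Q B_coeff L)"
      by (simp add: B_coeff_eq mcoeff_comult_explog[OF gen])
    also have "\<dots> \<in> int_mod.span ?T"
    proof (rule int_mod.span_sum)
      fix p
      show "(case p of (K, L) \<Rightarrow> B_coeff K \<otimes>\<^sub>Q B_coeff L) \<in> int_mod.span ?T"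
        using pure by (cases p) (simp only: prod.case int_mod.span_base)
    qed
    finally show "comult b \<in> int_mod.span ?T" .
  qed
  have counit: "counit a \<in> \<int>" if "a \<in> ?R" for a
  proof -
    have "counit a \<in> int_mod.span {1}"
    proof (rule rat_linear_span_image[where f = counit and S = "range B_coeff"])
      show "a \<in> int_mod.span (range B_coeff)" using that by (simp add: R\<^sub>\<Gamma>_def)
      show "rat_linear (counit :: 'g center uea \<Rightarrow> _)" by (rule rat_alg_hom_linear[OF rat_alg_hom_counit])
      show "counit b \<in> int_mod.span {1}" if "b \<in> range B_coeff" for b :: "'g center uea"
        using that by (auto simp: B_coeff_eq mcoeff_counit_explog[OF gen] int_mod.span_base int_mod.span_zero)
    qed
    then show ?thesis by (auto simp: int_mod.span_singleton)
  qed
  have antipode: "antipode a \<in> ?R" if "a \<in> ?R" for a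
    unfolding R\<^sub>\<Gamma>_def
  proof (rule rat_linear_span_image[where f = antipode and S = "range B_coeff"])
    show "a \<in> int_mod.span (range B_coeff)" using that by (simp add: R\<^sub>\<Gamma>_def)
    show "rat_linear (antipode :: 'g center uea \<Rightarrow> _)" by (rule rat_alg_hom_linear[OF rat_alg_hom_antipode])
    have "mmap antipode (explog gen_series) \<in> coeffs_in ?R"
      unfolding mmap_antipode_explog[OF gen]
      by (intro explog_coeffs_in mcoeff_minv_0 gen minv_coeffs_in is_subring_integral_center gen_series_coeffs_in)
    then show "antipode b \<in> int_mod.span (range B_coeff)" if "b \<in> range B_coeff" for b :: "'g center uea"
      using that by (auto simp: B_coeff_eq coeffs_in_def R\<^sub>\<Gamma>_def)
  qed
  have add: "0 \<in> ?R" "\<And>a b. a \<in> ?R \<Longrightarrow> b \<in> ?R \<Longrightarrow> a + b \<in> ?R" "\<And>a. a \<in> ?R \<Longrightarrow> - a \<in> ?R"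
    unfolding R\<^sub>\<Gamma>_def by (fact int_mod.span_zero int_mod.span_add int_mod.span_neg)+
  show ?thesis
    unfolding hopf_subalgebra_over_int_def image_subset_iff
    by (intro conjI ballI) (fact one mult comult counit antipode add)+
qed

end
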